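(* Let $d \ge 2$ and let $H$ be the directed $d$-dimensional hypercube. Fix integers $0 \le i < j \le d$ with $j - i \ge 2$. Let $(S,T;\phi)$ be a matched pair with $S \subseteq L_i$ and $T \subseteq L_j$. Then there exist two collections $\mathcal{P}_1, \mathcal{P}_2$ of directed paths in $H$ such that, for each $k \in \{1,2\}$, $\mathcal{P}_k$ consists of $|S| = |T|$ pairwise vertex-disjoint directed paths, each starting at a vertex of $S$ and ending at a vertex of $T$, and such that all paths in $\mathcal{P}_1 \cup \mathcal{P}_2$ are pairwise edge-disjoint.
   Context: The directed $d$-dimensional hypercube $H$ has vertex set $\{0,1\}^d$ and a directed edge $(x,y)$ whenever $x$ and $y$ differ in exactly one coordinate and $y$ has one more $1$ than $x$ (edges point from lower to higher Hamming weight). For $x,y \in \{0,1\}^d$, write $x \preceq y$ if $x_i \le y_i$ for all $i$, and $x \prec y$ if $x \preceq y$ and $x \ne y$. The $i$-th layer is $L_i = \{x \in \{0,1\}^d : \|x\|_1 = i\}$. Two subsets $S, T \subseteq \{0,1\}^d$ form a matched pair $(S,T;\phi)$ if $\phi : S \to T$ is a bijection with $s \prec \phi(s)$ for every $s \in S$. The paths are not required to connect $s$ to $\phi(s)$. *)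

theory Defs
  imports "Graph_Theory.Graph_Theory" "HOL-Library.FuncSet"
begin

type_synonym vertex = "nat \<Rightarrow> nat"

(* A point of {0,1}^d is an extensional function on {1..d}, so that two vertices are equal
   iff all d coordinates agree. *)
definition cube :: "nat \<Rightarrow> vertex set" where
  "cube d = {1..d} \<rightarrow>\<^sub>E {0, 1}"

definition hypercube :: "nat \<Rightarrow> vertex pair_pre_digraph" where
  "hypercube d =
     \<lparr> pverts = cube d,
       parcs = {(x, y). x \<in> cube d \<and> y \<in> cube d \<and>
                  card {k \<in> {1..d}. x k \<noteq> y k} = 1 \<and>
                  card {k \<in> {1..d}. y k = 1} = card {k \<in> {1..d}. x k = 1} + 1} \<rparr>"

definition cube_le :: "nat \<Rightarrow> vertex \<Rightarrow> vertex \<Rightarrow> bool" where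
  "cube_le d x y \<longleftrightarrow> (\<forall>k\<in>{1..d}. x k \<le> y k)"

definition cube_less :: "nat \<Rightarrow> vertex \<Rightarrow> vertex \<Rightarrow> bool" where
  "cube_less d x y \<longleftrightarrow> cube_le d x y \<and> x \<noteq> y"

definition layer :: "nat \<Rightarrow> nat \<Rightarrow> vertex set" where
  "layer d i = {x \<in> cube d. (\<Sum>k = 1..d. x k) = i}"

definition matched_pair :: "nat \<Rightarrow> vertex set \<Rightarrow> vertex set \<Rightarrow> (vertex \<Rightarrow> vertex) \<Rightarrow> bool" where
  "matched_pair d S T \<phi> \<longleftrightarrow>
     S \<subseteq> cube d \<and> T \<subseteq> cube d \<and> bij_betw \<phi> S T \<and> (\<forall>s\<in>S. cube_less d s (\<phi> s))"

definition vertex_disjoint :: "'a vwalk \<Rightarrow> 'a vwalk \<Rightarrow> bool" where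
  "vertex_disjoint p q \<longleftrightarrow> set p \<inter> set q = {}"

definition edge_disjoint :: "'a vwalk \<Rightarrow> 'a vwalk \<Rightarrow> bool" where
  "edge_disjoint p q \<longleftrightarrow> set (vwalk_arcs p) \<inter> set (vwalk_arcs q) = {}"

definition disjoint_path_collection ::
    "nat \<Rightarrow> vertex set \<Rightarrow> vertex set \<Rightarrow> vertex vwalk set \<Rightarrow> bool" where
  "disjoint_path_collection d S T P \<longleftrightarrow>
     finite P \<and> card P = card S \<and> card P = card T \<and>
     (\<forall>p\<in>P. vpath p (with_proj (hypercube d)) \<and> hd p \<in> S \<and> last p \<in> T) \<and>
     pairwise vertex_disjoint P"

(* Edge-disjointness of all paths of two collections taken together.  The cross condition also
   covers p = q, so a path may not be used in both collections; requiring pairwise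
   disjointness on the set P1 \<union> P2 alone would allow that. *)
definition jointly_edge_disjoint :: "'a vwalk set \<Rightarrow> 'a vwalk set \<Rightarrow> bool" where
  "jointly_edge_disjoint P1 P2 \<longleftrightarrow>
     pairwise edge_disjoint P1 \<and> pairwise edge_disjoint P2 \<and>
     (\<forall>p\<in>P1. \<forall>q\<in>P2. edge_disjoint p q)"

end

theory Submission
  imports Defs
begin

text \<open>
  Vertices are subsets of \<open>{1..d}\<close>. Both collections are found together as one integral flow with
  edge capacity 1 and vertex capacity 2 in which every source sends 2 and every sink receives 2.
  The claim is proved for all flow demands in \<open>{0, 1, 2}\<close>: if the demands can be matched
  along inclusions between levels \<open>i\<close> and \<open>j \<ge> i + 2\<close>, then such a flow exists.

  By induction on \<open>j - i\<close> it suffices to route the demands through one level \<open>q\<close> next to \<open>i\<close> or to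
  \<open>j\<close> (unit edges on that side, inclusions on the other), and by a max-flow min-cut theorem only a
  cut condition at level \<open>q\<close> is needed. In a counterexample of minimal total demand it fails at both
  levels \<open>i + 1\<close> and \<open>j - 1\<close>; a flow for the demand reduced by one unit then saturates both
  levels. Among the vertices lying between a source and a sink, out-degrees weakly decrease and
  in-degrees weakly increase along edges. Saturation makes the load-weighted sum of in-degrees
  exceed that of out-degrees at level \<open>i + 1\<close>, and the reverse at level \<open>j - 1\<close>, which is absurd.

  Finally the flow is 2-coloured: splitting each vertex into an out-copy and an in-copy, joined by an
  extra edge where the load is 1, gives a 2-regular bipartite graph, and a perfect matching together
  with its complement yields the two collections.
\<close>

section \<open>Integral transport\<close>

text \<open>Truncation keeps an additive set function submodular: the sums over union and
  intersection have the same total as those over \<open>U\<close> and \<open>V\<close> but lie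
  further apart, and \<open>min q\<close> is concave.\<close>

lemma min_sum_submodular:
  fixes u :: "'a \<Rightarrow> nat"
  assumes "finite U" "finite V"
  shows "min q (sum u (U \<union> V)) + min q (sum u (U \<inter> V)) \<le> min q (sum u U) + min q (sum u V)"
proof -
  have "sum u (U \<union> V) + sum u (U \<inter> V) = sum u U + sum u V"
    using sum.union_inter[OF assms, of u] .
  moreover have "sum u (U \<inter> V) \<le> sum u U" "sum u (U \<inter> V) \<le> sum u V"
    using assms by (auto intro: sum_mono2)
  ultimately show ?thesis by linarith
qed

text \<open>Max-flow min-cut for a bipartite network with supplies \<open>p\<close>, receiving
  limits \<open>q\<close> and edge capacities \<open>u\<close>. The right side of the hypothesis is
  the cost of a cut with \<open>X\<close> on the source side, each receiver \<open>y\<close> being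
  cut in its cheaper way. The proof sends one unit at a time along an edge whose use preserves the
  condition.\<close>

lemma transport:
  fixes p :: "'a \<Rightarrow> nat" and q :: "'b \<Rightarrow> nat" and u :: "'a \<Rightarrow> 'b \<Rightarrow> nat"
  assumes "finite L" "finite R"
    and "\<And>X. X \<subseteq> L \<Longrightarrow> (\<Sum>x\<in>X. p x) \<le> (\<Sum>y\<in>R. min (q y) (\<Sum>x\<in>X. u x y))"
  shows "\<exists>z. (\<forall>x\<in>L. \<forall>y\<in>R. z x y \<le> u x y) \<and> (\<forall>x\<in>L. (\<Sum>y\<in>R. z x y) = p x) \<and>
             (\<forall>y\<in>R. (\<Sum>x\<in>L. z x y) \<le> q y)"
  using assms(3)
proof (induction "\<Sum>x\<in>L. p x" arbitrary: p q u)
  case 0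
  then have "\<forall>x\<in>L. p x = 0" using assms(1) by simp
  then show ?case by (intro exI[of _ "\<lambda>_ _. 0"]) simp
next
  case (Suc n)
  let ?rho = "\<lambda>X. \<Sum>y\<in>R. min (q y) (\<Sum>x\<in>X. u x y)"
  obtain x0 where x0: "x0 \<in> L" "p x0 > 0"
  proof -
    have "\<exists>x\<in>L. p x \<noteq> 0"
    proof (rule ccontr)
      assume "\<not> ?thesis"
      then have "sum p L = 0" by (intro sum.neutral) auto
      then show False using Suc.hyps(2) by simp
    qed
    then show thesis using that by auto
  qed
  \<comment> \<open>Tight sets are closed under union, so there is a largest one avoiding \<open>x0\<close>; any edge from \<open>x0\<close>
    that it does not block can be used.\<close>
  define tight where "tight = {X. X \<subseteq> L - {x0} \<and> sum p X = ?rho X}"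
  have fin: "finite X" if "X \<subseteq> L" for X using that assms(1) finite_subset by blast
  \<comment> \<open>Uncrossing: \<open>?rho\<close> is submodular and \<open>sum p\<close> is
    modular, so equality on \<open>U\<close> and \<open>V\<close> forces equality on their
    union.\<close>
  have tight_Un: "U \<union> V \<in> tight" if "U \<in> tight" "V \<in> tight" for U V
  proof -
    have UV: "U \<subseteq> L - {x0}" "V \<subseteq> L - {x0}" "sum p U = ?rho U" "sum p V = ?rho V"
      using that by (auto simp: tight_def)
    then have f: "finite U" "finite V" by (auto intro: fin)
    have "?rho (U \<union> V) + ?rho (U \<inter> V) \<le> ?rho U + ?rho V"
      unfolding sum.distrib[symmetric] by (intro sum_mono min_sum_submodular f)
    also have "\<dots> = sum p (U \<union> V) + sum p (U \<inter> V)"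
      using sum.union_inter[OF f, of p] UV by simp
    also have "sum p (U \<inter> V) \<le> ?rho (U \<inter> V)"
      using UV by (intro Suc.prems) auto
    finally have "?rho (U \<union> V) \<le> sum p (U \<union> V)" by simp
    moreover have "sum p (U \<union> V) \<le> ?rho (U \<union> V)" using UV by (intro Suc.prems) auto
    ultimately show ?thesis using UV by (auto simp: tight_def)
  qed
  have "finite tight" unfolding tight_def using assms(1) by simp
  moreover have "{} \<in> tight" by (simp add: tight_def)
  ultimately obtain M where M: "M \<in> tight" "\<And>X. X \<in> tight \<Longrightarrow> M \<subseteq> X \<Longrightarrow> X = M"
    using finite_has_maximal[of tight] by blast
  have Mmax: "X \<subseteq> M" if "X \<in> tight" for X
    using M(2)[of "M \<union> X"] tight_Un[OF M(1) that] by blast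
  have Msub: "M \<subseteq> L" "x0 \<notin> M" "finite M" and Mt: "sum p M = ?rho M"
    using M(1) fin[of M] by (auto simp: tight_def)
  \<comment> \<open>\<open>M\<close> is tight and \<open>x0\<close> still has supply, so adding
    \<open>x0\<close> must raise \<open>?rho\<close>. Some receiver \<open>y0\<close> therefore has
    room beyond what \<open>M\<close> can send it, together with positive capacity from
    \<open>x0\<close>.\<close>
  have "?rho M < ?rho (insert x0 M)"
  proof -
    have "?rho M < sum p (insert x0 M)" using Msub x0 Mt by simp
    also have "\<dots> \<le> ?rho (insert x0 M)" using Msub x0 by (intro Suc.prems) auto
    finally show ?thesis .
  qed
  then obtain y0 where y0: "y0 \<in> R"
    "min (q y0) (\<Sum>x\<in>M. u x y0) < min (q y0) (\<Sum>x\<in>insert x0 M. u x y0)"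
    using sum_mono[of R "\<lambda>y. min (q y) (\<Sum>x\<in>insert x0 M. u x y)" "\<lambda>y. min (q y) (\<Sum>x\<in>M. u x y)"]
    by (meson not_le)
  have "(\<Sum>x\<in>insert x0 M. u x y0) = u x0 y0 + (\<Sum>x\<in>M. u x y0)" using Msub by simp
  then have y0': "u x0 y0 > 0" "(\<Sum>x\<in>M. u x y0) < q y0" using y0(2) by linarith+
  define p' where "p' = p(x0 := p x0 - 1)"
  define q' where "q' = q(y0 := q y0 - 1)"
  define u' where "u' = (\<lambda>x y. if x = x0 \<and> y = y0 then u x y - 1 else u x y)"
  have sp': "sum p' X + (if x0 \<in> X then 1 else 0) = sum p X" if "X \<subseteq> L" for X
  proof (cases "x0 \<in> X")
    case True
    have "sum p X = p x0 + sum p (X - {x0})" "sum p' X = p' x0 + sum p' (X - {x0})"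
      by (rule sum.remove[OF fin[OF that] True])+
    moreover have "sum p (X - {x0}) = sum p' (X - {x0})" by (intro sum.cong) (auto simp: p'_def)
    moreover have "p' x0 + 1 = p x0" using x0 by (simp add: p'_def)
    moreover have "(if x0 \<in> X then 1 else 0) = (1::nat)" using True by simp
    ultimately show ?thesis by linarith
  next
    case False
    then show ?thesis by (auto simp: p'_def intro!: sum.cong)
  qed
  have su': "(\<Sum>x\<in>X. u' x y) + (if x0 \<in> X \<and> y = y0 then 1 else 0) = (\<Sum>x\<in>X. u x y)"
    if "X \<subseteq> L" for X y
  proof (cases "x0 \<in> X \<and> y = y0")
    case True
    then have x: "x0 \<in> X" and y: "y = y0" by auto
    have "(\<Sum>x\<in>X. u x y) = u x0 y + (\<Sum>x\<in>X - {x0}. u x y)"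
      "(\<Sum>x\<in>X. u' x y) = u' x0 y + (\<Sum>x\<in>X - {x0}. u' x y)"
      by (rule sum.remove[OF fin[OF that] x])+
    moreover have "(\<Sum>x\<in>X - {x0}. u' x y) = (\<Sum>x\<in>X - {x0}. u x y)"
      by (intro sum.cong) (auto simp: u'_def)
    moreover have "u' x0 y + 1 = u x0 y" using y y0' by (simp add: u'_def)
    moreover have "(if x0 \<in> X \<and> y = y0 then 1 else 0) = (1::nat)" using True by simp
    ultimately show ?thesis by linarith
  next
    case False
    then show ?thesis by (auto simp: u'_def intro!: sum.cong)
  qed
  let ?rho' = "\<lambda>X. \<Sum>y\<in>R. min (q' y) (\<Sum>x\<in>X. u' x y)"
  have split: "sum g R = g y0 + sum g (R - {y0})" for g :: "'b \<Rightarrow> nat"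
    using sum.remove[OF assms(2) y0(1)] .
  have others: "(\<Sum>y\<in>R - {y0}. min (q' y) (\<Sum>x\<in>X. u' x y)) = (\<Sum>y\<in>R - {y0}. min (q y) (\<Sum>x\<in>X. u x y))"
    if "X \<subseteq> L" for X
  proof (rule sum.cong[OF refl])
    fix y assume "y \<in> R - {y0}"
    then show "min (q' y) (\<Sum>x\<in>X. u' x y) = min (q y) (\<Sum>x\<in>X. u x y)"
      using su'[OF that, of y] by (simp add: q'_def)
  qed
  \<comment> \<open>The condition survives the shipment of one unit. If \<open>x0\<close> is in
    \<open>X\<close>, the left side drops by one and the right side by at most one. A tight
    \<open>X\<close> without \<open>x0\<close> lies inside \<open>M\<close> and does not fill
    \<open>y0\<close>, so its right side is unchanged. Any other \<open>X\<close> has a spare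
    unit.\<close>
  have cond: "sum p' X \<le> ?rho' X" if X: "X \<subseteq> L" for X
  proof -
    have le: "sum p X \<le> ?rho X" using Suc.prems[OF X] .
    show ?thesis
    proof (cases "x0 \<in> X")
      case True
      have "min (q y0) (\<Sum>x\<in>X. u x y0) \<le> min (q' y0) (\<Sum>x\<in>X. u' x y0) + 1"
        using su'[OF X, of y0] True y0' by (auto simp: q'_def min_def)
      then show ?thesis using le sp'[OF X] True others[OF X] split[of "\<lambda>y. min (q y) (\<Sum>x\<in>X. u x y)"]
          split[of "\<lambda>y. min (q' y) (\<Sum>x\<in>X. u' x y)"] by simp
    next
      case False
      show ?thesis
      proof (cases "X \<in> tight")
        case True
        have "(\<Sum>x\<in>X. u x y0) \<le> (\<Sum>x\<in>M. u x y0)"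
          using Mmax[OF True] Msub by (intro sum_mono2) auto
        then have "min (q y0) (\<Sum>x\<in>X. u x y0) = min (q' y0) (\<Sum>x\<in>X. u' x y0)"
          using su'[OF X, of y0] False y0' by (auto simp: q'_def min_def)
        then show ?thesis using le sp'[OF X] False others[OF X] split[of "\<lambda>y. min (q y) (\<Sum>x\<in>X. u x y)"]
            split[of "\<lambda>y. min (q' y) (\<Sum>x\<in>X. u' x y)"] by simp
      next
        case nt: False
        then have "sum p X < ?rho X" using X False le by (auto simp: tight_def)
        moreover have "min (q y0) (\<Sum>x\<in>X. u x y0) \<le> min (q' y0) (\<Sum>x\<in>X. u' x y0) + 1"
          using su'[OF X, of y0] False by (auto simp: q'_def min_def)
        ultimately show ?thesis using sp'[OF X] False others[OF X] split[of "\<lambda>y. min (q y) (\<Sum>x\<in>X. u x y)"]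
            split[of "\<lambda>y. min (q' y) (\<Sum>x\<in>X. u' x y)"] by simp
      qed
    qed
  qed
  have "n = sum p' L" using sp'[of L] x0 Suc.hyps(2) by simp
  from Suc.hyps(1)[OF this cond] obtain z where z:
    "\<forall>x\<in>L. \<forall>y\<in>R. z x y \<le> u' x y" "\<forall>x\<in>L. (\<Sum>y\<in>R. z x y) = p' x" "\<forall>y\<in>R. (\<Sum>x\<in>L. z x y) \<le> q' y"
    by blast
  define z' where "z' = (\<lambda>x y. z x y + (if x = x0 \<and> y = y0 then 1 else 0))"
  have "(\<Sum>y\<in>R. z' x y) = p x" if "x \<in> L" for x
  proof -
    have "(\<Sum>y\<in>R. z' x y) = (\<Sum>y\<in>R. z x y) + (if x = x0 then 1 else 0)"
      unfolding z'_def sum.distrib using assms(2) y0 by (auto simp: sum.delta)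
    then show ?thesis using z(2) that x0 by (auto simp: p'_def)
  qed
  moreover have "(\<Sum>x\<in>L. z' x y) \<le> q y" if "y \<in> R" for y
  proof -
    have "(\<Sum>x\<in>L. z' x y) = (\<Sum>x\<in>L. z x y) + (if y = y0 then 1 else 0)"
      unfolding z'_def sum.distrib using assms(1) x0 by (auto simp: sum.delta)
    then show ?thesis using z(3) that y0' by (auto simp: q'_def split: if_splits)
  qed
  moreover have "z' x y \<le> u x y" if "x \<in> L" "y \<in> R" for x y
    using z(1) that y0' by (fastforce simp: z'_def u'_def split: if_splits)
  ultimately show ?case by blast
qed

text \<open>Max-flow min-cut for three levels with vertex capacity 2 in the middle. In
  \<open>cut\<close>, \<open>X\<close> collects the sources on the near side and \<open>Y\<close>
  the sinks on the far side; each middle vertex is separated in the cheapest of three ways: at the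
  vertex itself, at its edges from \<open>X\<close>, or at its edges to \<open>Y\<close>.\<close>

lemma two_stage_transport:
  fixes k :: "'a \<Rightarrow> nat" and l :: "'c \<Rightarrow> nat" and u :: "'a \<Rightarrow> 'b \<Rightarrow> nat" and v :: "'b \<Rightarrow> 'c \<Rightarrow> nat"
  assumes fin: "finite S" "finite W" "finite T"
    and total: "sum k S = sum l T"
    and cut: "\<And>X Y. X \<subseteq> S \<Longrightarrow> Y \<subseteq> T \<Longrightarrow>
      sum k X \<le> sum l (T - Y) + (\<Sum>w\<in>W. min 2 (min (\<Sum>x\<in>X. u x w) (\<Sum>y\<in>Y. v w y)))"
  obtains z1 z2 where
    "\<And>s w. s \<in> S \<Longrightarrow> w \<in> W \<Longrightarrow> z1 s w \<le> u s w"
    "\<And>w t. w \<in> W \<Longrightarrow> t \<in> T \<Longrightarrow> z2 w t \<le> v w t"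
    "\<And>s. s \<in> S \<Longrightarrow> (\<Sum>w\<in>W. z1 s w) = k s"
    "\<And>t. t \<in> T \<Longrightarrow> (\<Sum>w\<in>W. z2 w t) = l t"
    "\<And>w. w \<in> W \<Longrightarrow> (\<Sum>s\<in>S. z1 s w) = (\<Sum>t\<in>T. z2 w t)"
    "\<And>w. w \<in> W \<Longrightarrow> (\<Sum>s\<in>S. z1 s w) \<le> (2::nat)"
proof -
  \<comment> \<open>Each \<open>w\<close> is split into a supplier and a consumer of 2 units; what \<open>w\<close> ships to itself is its
    unused capacity.\<close>
  define p where "p = case_sum k (\<lambda>_::'b. 2::nat)"
  define q where "q = case_sum (\<lambda>_::'b. 2::nat) l"
  define uu where "uu = (\<lambda>x y. case x of
      Inl s \<Rightarrow> (case y of Inl w \<Rightarrow> u s w | Inr t \<Rightarrow> 0)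
    | Inr w \<Rightarrow> (case y of Inl w' \<Rightarrow> if w = w' then 2 else 0 | Inr t \<Rightarrow> v w t))"
  have sumL: "sum g (A <+> B) = (\<Sum>a\<in>A. g (Inl a)) + (\<Sum>b\<in>B. g (Inr b))"
    if "finite A" "finite B" for g :: "'d + 'e \<Rightarrow> nat" and A B
    using sum.Plus[OF that, of g] by (simp add: comp_def)
  let ?L = "S <+> W" and ?R = "W <+> T"
  have "\<exists>z. (\<forall>x\<in>?L. \<forall>y\<in>?R. z x y \<le> uu x y) \<and> (\<forall>x\<in>?L. (\<Sum>y\<in>?R. z x y) = p x) \<and>
             (\<forall>y\<in>?R. (\<Sum>x\<in>?L. z x y) \<le> q y)"
  proof (rule transport)
    show "finite ?L" "finite ?R" using fin by auto
    fix X assume X: "X \<subseteq> ?L"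
    define XS XW where "XS = Inl -` X" and "XW = Inr -` X"
    have XX: "X = XS <+> XW"
    proof (intro set_eqI iffI)
      fix a assume "a \<in> X" then show "a \<in> XS <+> XW" by (cases a) (auto simp: XS_def XW_def)
    qed (auto simp: XS_def XW_def)
    have sub: "XS \<subseteq> S" "XW \<subseteq> W" using X by (auto simp: XS_def XW_def)
    have finX: "finite XS" "finite XW" using sub fin finite_subset by blast+
    \<comment> \<open>These are the sinks whose minimum is attained by the incoming edges; at every
      other sink the minimum is the demand \<open>l t\<close>.\<close>
    define Y where "Y = {t\<in>T. (\<Sum>w\<in>XW. v w t) < l t}"
    have Y: "Y \<subseteq> T" "finite Y" using fin by (auto simp: Y_def)
    have su1: "(\<Sum>x\<in>X. uu x (Inl w)) = (\<Sum>s\<in>XS. u s w) + (if w \<in> XW then 2 else 0)" for w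
      unfolding XX sumL[OF finX] by (simp add: uu_def finX)
    have su2: "(\<Sum>x\<in>X. uu x (Inr t)) = (\<Sum>w\<in>XW. v w t)" for t
      unfolding XX sumL[OF finX] by (simp add: uu_def)
    have "(\<Sum>t\<in>T. min (l t) (\<Sum>w\<in>XW. v w t))
        = (\<Sum>t\<in>T - Y. min (l t) (\<Sum>w\<in>XW. v w t)) + (\<Sum>t\<in>Y. min (l t) (\<Sum>w\<in>XW. v w t))"
      using sum.subset_diff[OF Y(1) fin(3)] .
    also have "(\<Sum>t\<in>T - Y. min (l t) (\<Sum>w\<in>XW. v w t)) = sum l (T - Y)"
      by (intro sum.cong) (auto simp: Y_def)
    also have "(\<Sum>t\<in>Y. min (l t) (\<Sum>w\<in>XW. v w t)) = (\<Sum>t\<in>Y. \<Sum>w\<in>XW. v w t)"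
      by (intro sum.cong) (auto simp: Y_def)
    also have "\<dots> = (\<Sum>w\<in>XW. \<Sum>t\<in>Y. v w t)" by (rule sum.swap)
    finally have A: "(\<Sum>t\<in>T. min (l t) (\<Sum>w\<in>XW. v w t)) = sum l (T - Y) + (\<Sum>w\<in>XW. \<Sum>t\<in>Y. v w t)" .
    have "(\<Sum>w\<in>W. min 2 (\<Sum>x\<in>X. uu x (Inl w)))
        = (\<Sum>w\<in>W - XW. min 2 (\<Sum>x\<in>X. uu x (Inl w))) + (\<Sum>w\<in>XW. min 2 (\<Sum>x\<in>X. uu x (Inl w)))"
      using sum.subset_diff[OF sub(2) fin(2)] .
    also have "(\<Sum>w\<in>XW. min 2 (\<Sum>x\<in>X. uu x (Inl w))) = 2 * card XW"
      by (simp add: su1 min_def)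
    also have "(\<Sum>w\<in>W - XW. min 2 (\<Sum>x\<in>X. uu x (Inl w))) = (\<Sum>w\<in>W - XW. min 2 (\<Sum>s\<in>XS. u s w))"
      by (intro sum.cong) (auto simp: su1)
    finally have B: "(\<Sum>w\<in>W. min 2 (\<Sum>x\<in>X. uu x (Inl w)))
        = (\<Sum>w\<in>W - XW. min 2 (\<Sum>s\<in>XS. u s w)) + 2 * card XW" .
    let ?c = "\<lambda>w. min 2 (min (\<Sum>x\<in>XS. u x w) (\<Sum>y\<in>Y. v w y))"
    have "sum ?c W = sum ?c (W - XW) + sum ?c XW"
      using sum.subset_diff[OF sub(2) fin(2)] .
    also have "\<dots> \<le> (\<Sum>w\<in>W - XW. min 2 (\<Sum>s\<in>XS. u s w)) + (\<Sum>w\<in>XW. \<Sum>t\<in>Y. v w t)"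
      by (intro add_mono sum_mono) auto
    finally have C: "sum ?c W \<le> \<dots>" .
    have "sum p X = sum k XS + 2 * card XW" unfolding XX sumL[OF finX] by (simp add: p_def)
    also have "\<dots> \<le> sum l (T - Y) + sum ?c W + 2 * card XW" using cut[OF sub(1) Y(1)] by simp
    also have "\<dots> \<le> (\<Sum>w\<in>W. min 2 (\<Sum>x\<in>X. uu x (Inl w))) + (\<Sum>t\<in>T. min (l t) (\<Sum>w\<in>XW. v w t))"
      using A B C by linarith
    also have "\<dots> = (\<Sum>y\<in>?R. min (q y) (\<Sum>x\<in>X. uu x y))"
      unfolding sumL[OF fin(2,3)] by (simp add: q_def su2)
    finally show "sum p X \<le> (\<Sum>y\<in>?R. min (q y) (\<Sum>x\<in>X. uu x y))" .
  qed
  then obtain z where z: "\<And>x y. x \<in> ?L \<Longrightarrow> y \<in> ?R \<Longrightarrow> z x y \<le> uu x y"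
    "\<And>x. x \<in> ?L \<Longrightarrow> (\<Sum>y\<in>?R. z x y) = p x" "\<And>y. y \<in> ?R \<Longrightarrow> (\<Sum>x\<in>?L. z x y) \<le> q y" by blast
  \<comment> \<open>By \<open>total\<close> the supplies and the receiving limits have the same sum,
    so every limit is met with equality.\<close>
  have "(\<Sum>y\<in>?R. \<Sum>x\<in>?L. z x y) = (\<Sum>x\<in>?L. \<Sum>y\<in>?R. z x y)" by (rule sum.swap)
  also have "\<dots> = sum p ?L" using z(2) by (rule sum.cong[OF refl])
  also have "\<dots> = sum q ?R"
    unfolding sumL[OF fin(1,2)] sumL[OF fin(2,3)] by (simp add: p_def q_def total)
  finally have tot: "(\<Sum>y\<in>?R. \<Sum>x\<in>?L. z x y) = sum q ?R" .
  have col: "(\<Sum>x\<in>?L. z x y) = q y" if "y \<in> ?R" for y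
    by (rule sum_mono_inv[OF tot z(3) that]) (use fin in auto)
  define z1 where "z1 = (\<lambda>s w. z (Inl s) (Inl w))"
  define z2 where "z2 = (\<lambda>w t. z (Inr w) (Inr t))"
  have zero: "z (Inr w) (Inl w') = 0" if "w \<in> W" "w' \<in> W" "w \<noteq> w'" for w w'
    using z(1)[of "Inr w" "Inl w'"] that by (auto simp: uu_def)
  have zero': "z (Inl s) (Inr t) = 0" if "s \<in> S" "t \<in> T" for s t
    using z(1)[of "Inl s" "Inr t"] that by (auto simp: uu_def)
  have rowS: "(\<Sum>w\<in>W. z1 s w) = k s" if "s \<in> S" for s
    using z(2)[of "Inl s"] that unfolding sumL[OF fin(2,3)] by (simp add: z1_def p_def zero' InlI)
  have colT: "(\<Sum>w\<in>W. z2 w t) = l t" if "t \<in> T" for t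
    using col[of "Inr t"] that unfolding sumL[OF fin(1,2)] by (simp add: z2_def q_def zero' InrI)
  have rowW: "z (Inr w) (Inl w) + (\<Sum>t\<in>T. z2 w t) = 2" if "w \<in> W" for w
  proof -
    have "(\<Sum>w'\<in>W. z (Inr w) (Inl w')) = (\<Sum>w'\<in>W. if w' = w then z (Inr w) (Inl w) else 0)"
      using zero that by (intro sum.cong) auto
    also have "\<dots> = z (Inr w) (Inl w)" using that fin by simp
    finally show ?thesis
      using z(2)[of "Inr w"] that unfolding sumL[OF fin(2,3)] by (simp add: z2_def p_def InrI)
  qed
  have colW: "(\<Sum>s\<in>S. z1 s w) + z (Inr w) (Inl w) = 2" if "w \<in> W" for w
  proof -
    have "(\<Sum>w'\<in>W. z (Inr w') (Inl w)) = (\<Sum>w'\<in>W. if w' = w then z (Inr w) (Inl w) else 0)"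
      using zero that by (intro sum.cong) auto
    also have "\<dots> = z (Inr w) (Inl w)" using that fin by simp
    finally show ?thesis
      using col[of "Inl w"] that unfolding sumL[OF fin(1,2)] by (simp add: z1_def q_def InlI)
  qed
  show thesis
  proof (rule that[of z1 z2])
    show "z1 s w \<le> u s w" if "s \<in> S" "w \<in> W" for s w
      using z(1)[of "Inl s" "Inl w"] that by (simp add: z1_def uu_def InlI)
    show "z2 w t \<le> v w t" if "w \<in> W" "t \<in> T" for w t
      using z(1)[of "Inr w" "Inr t"] that by (simp add: z2_def uu_def InrI)
    show "(\<Sum>s\<in>S. z1 s w) = (\<Sum>t\<in>T. z2 w t)" "(\<Sum>s\<in>S. z1 s w) \<le> 2" if "w \<in> W" for w
      using rowW[OF that] colW[OF that] by linarith+
  qed (use rowS colT in auto)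
qed

section \<open>Flows through the levels of the subset lattice\<close>

definition uniform :: "nat \<Rightarrow> 'a set set \<Rightarrow> bool" where
  "uniform i S \<longleftrightarrow> finite S \<and> (\<forall>s\<in>S. finite s \<and> card s = i)"

definition between :: "'a set set \<Rightarrow> 'a set set \<Rightarrow> nat \<Rightarrow> 'a set set" where
  "between S T q = {w. card w = q \<and> (\<exists>s\<in>S. s \<subseteq> w) \<and> (\<exists>t\<in>T. w \<subseteq> t)}"

text \<open>Representing the flow by an edge set builds in edge capacity 1, and degrees play the
  role of flow values. Conservation and vertex capacity 2 are imposed strictly between levels
  \<open>i\<close> and \<open>j\<close>. Every edge is required to lie above a source and below a
  sink, so all vertices it meets belong to \<open>between S T\<close>.\<close>

definition layered_flow ::
    "nat \<Rightarrow> nat \<Rightarrow> 'a set set \<Rightarrow> 'a set set \<Rightarrow> ('a set \<Rightarrow> nat) \<Rightarrow> ('a set \<Rightarrow> nat) \<Rightarrow> ('a set \<times> 'a set) set \<Rightarrow> bool" where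
  "layered_flow i j S T k l E \<longleftrightarrow>
     finite E \<and>
     (\<forall>x y. (x, y) \<in> E \<longrightarrow> x \<subseteq> y \<and> card y = Suc (card x) \<and> i \<le> card x \<and> card y \<le> j \<and>
        (\<exists>s\<in>S. s \<subseteq> x) \<and> (\<exists>t\<in>T. y \<subseteq> t)) \<and>
     (\<forall>s\<in>S. card (E `` {s}) = k s) \<and>
     (\<forall>t\<in>T. card (E\<inverse> `` {t}) = l t) \<and>
     (\<forall>v. i < card v \<longrightarrow> card v < j \<longrightarrow> card (E `` {v}) = card (E\<inverse> `` {v}) \<and> card (E `` {v}) \<le> 2)"

text \<open>Neighbours of \<open>w\<close> inside the part of the lattice below \<open>T\<close> are
  recorded by the added element instead of by the neighbouring set. The direction sets of different
  vertices can then be compared by inclusion. The same holds for \<open>down_dirs\<close> and the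
  removed element.\<close>

definition up_dirs :: "'a set set \<Rightarrow> 'a set \<Rightarrow> 'a set" where
  "up_dirs T w = {f. f \<notin> w \<and> (\<exists>t\<in>T. insert f w \<subseteq> t)}"

definition down_dirs :: "'a set set \<Rightarrow> 'a set \<Rightarrow> 'a set" where
  "down_dirs S w = {e \<in> w. \<exists>s\<in>S. s \<subseteq> w - {e}}"

lemma uniformD: "uniform i S \<Longrightarrow> finite S" "uniform i S \<Longrightarrow> s \<in> S \<Longrightarrow> finite s" "uniform i S \<Longrightarrow> s \<in> S \<Longrightarrow> card s = i"
  by (auto simp: uniform_def)

lemma uniform_subset: "uniform i S \<Longrightarrow> S' \<subseteq> S \<Longrightarrow> uniform i S'"
  by (auto simp: uniform_def intro: finite_subset)

lemma uniform_between: "uniform j T \<Longrightarrow> uniform q (between S T q)"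
proof -
  assume T: "uniform j T"
  have "between S T q \<subseteq> (\<Union>t\<in>T. Pow t)" by (auto simp: between_def)
  moreover have "finite (\<Union>t\<in>T. Pow t)" using uniformD(1,2)[OF T] by auto
  ultimately have "finite (between S T q)" by (rule finite_subset)
  moreover have "finite w" if "w \<in> between S T q" for w
    using that uniformD(2)[OF T] by (auto simp: between_def intro: finite_subset)
  moreover have "card w = q" if "w \<in> between S T q" for w using that by (simp add: between_def)
  ultimately show ?thesis unfolding uniform_def by blast
qed

lemma layered_flowD:
  assumes "layered_flow i j S T k l E"
  shows "finite E"
    and "(x, y) \<in> E \<Longrightarrow> x \<subseteq> y"
    and "(x, y) \<in> E \<Longrightarrow> card y = Suc (card x)"
    and "(x, y) \<in> E \<Longrightarrow> i \<le> card x"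
    and "(x, y) \<in> E \<Longrightarrow> card y \<le> j"
    and "(x, y) \<in> E \<Longrightarrow> \<exists>s\<in>S. s \<subseteq> x"
    and "(x, y) \<in> E \<Longrightarrow> \<exists>t\<in>T. y \<subseteq> t"
    and "s \<in> S \<Longrightarrow> card (E `` {s}) = k s"
    and "t \<in> T \<Longrightarrow> card (E\<inverse> `` {t}) = l t"
    and "i < card v \<Longrightarrow> card v < j \<Longrightarrow> card (E `` {v}) = card (E\<inverse> `` {v})"
    and "i < card v \<Longrightarrow> card v < j \<Longrightarrow> card (E\<inverse> `` {v}) \<le> 2"
  using assms unfolding layered_flow_def by (blast, blast, blast, blast, blast, blast, blast, blast, blast, blast, metis)

lemma layered_flow_ends:
  assumes "layered_flow i j S T k l E" "uniform i S" "uniform j T"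
  shows "(x, y) \<in> E \<Longrightarrow> card x = i \<Longrightarrow> x \<in> S"
    and "(x, y) \<in> E \<Longrightarrow> card y = j \<Longrightarrow> y \<in> T"
    and "(x, y) \<in> E \<Longrightarrow> finite x \<and> finite y"
    and "(x, y) \<in> E \<Longrightarrow> x \<in> between S T (card x) \<and> y \<in> between S T (card y)"
proof -
  note F = layered_flowD[OF assms(1)] and S = uniformD[OF assms(2)] and T = uniformD[OF assms(3)]
  show fin: "finite x \<and> finite y" if "(x, y) \<in> E"
    using F(2)[OF that] F(7)[OF that] T(2) by (meson finite_subset)
  show "x \<in> S" if "(x, y) \<in> E" "card x = i"
    using F(6)[OF that(1)] fin[OF that(1)] S(3) that(2) by (metis card_subset_eq)
  show "y \<in> T" if "(x, y) \<in> E" "card y = j"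
    using F(7)[OF that(1)] T(2,3) that(2) by (metis card_subset_eq)
  show "x \<in> between S T (card x) \<and> y \<in> between S T (card y)" if "(x, y) \<in> E"
    using F(2)[OF that] F(6)[OF that] F(7)[OF that] unfolding between_def by blast
qed

text \<open>The two flows share only level \<open>q\<close>. There \<open>E1\<close> provides the
  in-edges and \<open>E2\<close> the out-edges, and both degrees are \<open>m w\<close> on
  \<open>W\<close> and zero elsewhere. The inclusion \<open>WB\<close> keeps all edges between
  \<open>S\<close> and \<open>T\<close>.\<close>

lemma layered_flow_glue:
  assumes E1: "layered_flow i q S W k m E1" and E2: "layered_flow q j W T m l E2"
    and S: "uniform i S" and W: "uniform q W" and T: "uniform j T"
    and "i < q" "q < j" and WB: "W \<subseteq> between S T q" and m: "\<And>w. w \<in> W \<Longrightarrow> m w \<le> 2"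
  shows "layered_flow i j S T k l (E1 \<union> E2)"
proof -
  note F1 = layered_flowD[OF E1] and F2 = layered_flowD[OF E2]
  note G1 = layered_flow_ends[OF E1 S W] and G2 = layered_flow_ends[OF E2 W T]
  have e1: "card y \<le> q \<and> card x < q" if "(x, y) \<in> E1" for x y
    using F1(3,5)[OF that] by linarith
  have e2: "q \<le> card x \<and> q < card y" if "(x, y) \<in> E2" for x y
    using F2(3,4)[OF that] by linarith
  have low: "(E1 \<union> E2) `` {v} = E1 `` {v}" if "card v < q" for v using e2 that by fastforce
  have low': "(E1 \<union> E2)\<inverse> `` {v} = E1\<inverse> `` {v}" if "card v \<le> q" for v using e2 that by fastforce
  have high: "(E1 \<union> E2) `` {v} = E2 `` {v}" if "q \<le> card v" for v using e1 that by fastforce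
  have high': "(E1 \<union> E2)\<inverse> `` {v} = E2\<inverse> `` {v}" if "q < card v" for v using e1 that by fastforce
  have mid: "card (E2 `` {v}) = card (E1\<inverse> `` {v}) \<and> card (E2 `` {v}) \<le> 2" if v: "card v = q" for v
  proof (cases "v \<in> W")
    case True
    then show ?thesis using F1(9) F2(8) m by simp
  next
    case False
    then have "E2 `` {v} = {}" "E1\<inverse> `` {v} = {}" using G1(2) G2(1) v by auto
    then show ?thesis by simp
  qed
  show ?thesis
    unfolding layered_flow_def
  proof (intro conjI allI impI ballI)
    show "finite (E1 \<union> E2)" using F1(1) F2(1) by simp
    fix x y assume xy: "(x, y) \<in> E1 \<union> E2"
    show "x \<subseteq> y" "card y = Suc (card x)" using xy F1(2,3) F2(2,3) by blast+
    show "i \<le> card x" "card y \<le> j" using xy F1(4,5)[of x y] F2(4,5)[of x y] assms(6,7) by auto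
    show "\<exists>s\<in>S. s \<subseteq> x"
    proof (cases "(x, y) \<in> E1")
      case False
      then obtain w where "w \<in> W" "w \<subseteq> x" using xy F2(6) by blast
      moreover from this obtain s where "s \<in> S" "s \<subseteq> w" using WB unfolding between_def by blast
      ultimately show ?thesis by blast
    qed (use F1(6) in blast)
    show "\<exists>t\<in>T. y \<subseteq> t"
    proof (cases "(x, y) \<in> E2")
      case False
      then obtain w where "w \<in> W" "y \<subseteq> w" using xy F1(7) by blast
      moreover from this obtain t where "t \<in> T" "w \<subseteq> t" using WB unfolding between_def by blast
      ultimately show ?thesis by blast
    qed (use F2(7) in blast)
  next
    fix s assume "s \<in> S" then show "card ((E1 \<union> E2) `` {s}) = k s"
      using low[of s] uniformD(3)[OF S] \<open>i < q\<close> F1(8) by simp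
  next
    fix t assume "t \<in> T" then show "card ((E1 \<union> E2)\<inverse> `` {t}) = l t"
      using high'[of t] uniformD(3)[OF T] \<open>q < j\<close> F2(9) by simp
  next
    fix v :: "'a set" assume v: "i < card v" "card v < j"
    consider "card v < q" | "card v = q" | "q < card v" by linarith
    then have "card ((E1 \<union> E2) `` {v}) = card ((E1 \<union> E2)\<inverse> `` {v}) \<and> card ((E1 \<union> E2) `` {v}) \<le> 2"
    proof cases
      case 1
      then show ?thesis using low[of v] low'[of v] F1(10,11)[of v] v by simp
    next
      case 2
      then show ?thesis using high[of v] low'[of v] mid[of v] by simp
    next
      case 3
      then show ?thesis using high[of v] high'[of v] F2(10,11)[of v] v by simp
    qed
    then show "card ((E1 \<union> E2) `` {v}) = card ((E1 \<union> E2)\<inverse> `` {v})" "card ((E1 \<union> E2) `` {v}) \<le> 2"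
      by auto
  qed
qed

lemma sum_01_card:
  fixes z :: "'b \<Rightarrow> nat"
  assumes "finite B" "\<And>y. y \<in> B \<Longrightarrow> z y \<le> 1"
  shows "card {y\<in>B. z y = 1} = (\<Sum>y\<in>B. z y)"
proof -
  have "(\<Sum>y\<in>B. z y) = (\<Sum>y\<in>B. if z y = 1 then 1 else 0)"
  proof (rule sum.cong[OF refl])
    fix y assume "y \<in> B"
    then have "z y \<le> 1" by (rule assms(2))
    then show "z y = (if z y = 1 then 1 else 0)" by auto
  qed
  then show ?thesis using assms(1) by (simp add: sum.inter_filter[symmetric])
qed

text \<open>Base case for adjacent levels: a 0/1 transport is an edge set, and no level lies
  strictly between, so only the degrees at \<open>A\<close> and \<open>B\<close> have to be
  counted.\<close>

lemma layered_flow_single: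
  fixes z :: "'a set \<Rightarrow> 'a set \<Rightarrow> nat"
  assumes A: "uniform a A" and B: "uniform (Suc a) B"
    and z: "\<And>x y. x \<in> A \<Longrightarrow> y \<in> B \<Longrightarrow> z x y \<le> 1"
      "\<And>x y. x \<in> A \<Longrightarrow> y \<in> B \<Longrightarrow> z x y > 0 \<Longrightarrow> x \<subseteq> y"
  shows "layered_flow a (Suc a) A B (\<lambda>x. \<Sum>y\<in>B. z x y) (\<lambda>y. \<Sum>x\<in>A. z x y)
           {(x, y). x \<in> A \<and> y \<in> B \<and> z x y = 1}" (is "layered_flow _ _ _ _ _ _ ?E")
  unfolding layered_flow_def
proof (intro conjI allI impI ballI)
  have "?E \<subseteq> A \<times> B" by auto
  then show "finite ?E" using uniformD(1)[OF A] uniformD(1)[OF B] finite_subset by blast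
  fix x y assume "(x, y) \<in> ?E"
  then show "x \<subseteq> y" "card y = Suc (card x)" "a \<le> card x" "card y \<le> Suc a"
      "\<exists>s\<in>A. s \<subseteq> x" "\<exists>t\<in>B. y \<subseteq> t"
    using z(2)[of x y] uniformD(3)[OF A] uniformD(3)[OF B] by auto
next
  fix x assume x: "x \<in> A"
  have "?E `` {x} = {y\<in>B. z x y = 1}" using x by auto
  then show "card (?E `` {x}) = (\<Sum>y\<in>B. z x y)"
    using sum_01_card[of B "z x"] uniformD(1)[OF B] z(1) x by simp
next
  fix y assume y: "y \<in> B"
  have "?E\<inverse> `` {y} = {x\<in>A. z x y = 1}" using y by auto
  then show "card (?E\<inverse> `` {y}) = (\<Sum>x\<in>A. z x y)"
    using sum_01_card[of A "\<lambda>x. z x y"] uniformD(1)[OF A] z(1) y by simp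
qed auto

section \<open>Counting edges by their tails and heads\<close>

lemma sum_out_degree:
  fixes g :: "'v \<Rightarrow> nat"
  assumes "finite E" "finite V"
  shows "(\<Sum>x\<in>V. card (E `` {x}) * g x) = (\<Sum>e\<in>{e\<in>E. fst e \<in> V}. g (fst e))"
proof -
  have fin: "finite (E `` {x})" for x using assms(1) by (rule finite_Image)
  have "{e\<in>E. fst e \<in> V} = Sigma V (\<lambda>x. E `` {x})" by auto
  moreover have "(\<Sum>x\<in>V. \<Sum>y\<in>E `` {x}. g x) = (\<Sum>(x, y)\<in>Sigma V (\<lambda>x. E `` {x}). g x)"
    by (rule sum.Sigma) (use assms fin in auto)
  ultimately show ?thesis by (simp add: case_prod_unfold)
qed

lemma sum_in_degree:
  fixes g :: "'v \<Rightarrow> nat"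
  assumes "finite E" "finite V"
  shows "(\<Sum>y\<in>V. card (E\<inverse> `` {y}) * g y) = (\<Sum>e\<in>{e\<in>E. snd e \<in> V}. g (snd e))"
proof -
  have "(\<Sum>y\<in>V. card (E\<inverse> `` {y}) * g y) = (\<Sum>e\<in>{e\<in>E\<inverse>. fst e \<in> V}. g (fst e))"
    by (rule sum_out_degree) (use assms in auto)
  also have "\<dots> = (\<Sum>e\<in>{e\<in>E. snd e \<in> V}. g (snd e))"
    by (rule sum.reindex_bij_witness[of _ prod.swap prod.swap]) auto
  finally show ?thesis .
qed

text \<open>Edges leaving one level are those entering the next, so a sum over them can be evaluated
  at either end. In the boundary cases \<open>S\<close> and \<open>T\<close> stand for the first and
  the last level.\<close>

lemma layered_flow_edges:
  assumes "layered_flow i j S T k l E" "uniform i S" "uniform j T"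
  shows "{e\<in>E. fst e \<in> between S T q} = {e\<in>E. snd e \<in> between S T (Suc q)}"
    and "{e\<in>E. fst e \<in> S} = {e\<in>E. snd e \<in> between S T (Suc i)}"
    and "i < j \<Longrightarrow> {e\<in>E. fst e \<in> between S T (j - 1)} = {e\<in>E. snd e \<in> T}"
proof -
  note F = layered_flowD[OF assms(1)] and G = layered_flow_ends[OF assms]
  have 1: "fst e \<in> between S T r \<longleftrightarrow> card (fst e) = r"
    "snd e \<in> between S T r \<longleftrightarrow> card (snd e) = r" "card (snd e) = Suc (card (fst e))"
    if "e \<in> E" for e r
    using G(4)[of "fst e" "snd e"] F(3)[of "fst e" "snd e"] that by (auto simp: between_def)
  have 2: "fst e \<in> S \<longleftrightarrow> card (fst e) = i" "snd e \<in> T \<longleftrightarrow> card (snd e) = j" if "e \<in> E" for e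
    using G(1,2)[of "fst e" "snd e"] uniformD(3)[OF assms(2)] uniformD(3)[OF assms(3)] that by auto
  show "{e\<in>E. fst e \<in> between S T q} = {e\<in>E. snd e \<in> between S T (Suc q)}"
    by (rule Collect_cong) (metis 1 nat.inject)
  show "{e\<in>E. fst e \<in> S} = {e\<in>E. snd e \<in> between S T (Suc i)}"
    by (rule Collect_cong) (metis 1 2 nat.inject)
  show "{e\<in>E. fst e \<in> between S T (j - 1)} = {e\<in>E. snd e \<in> T}" if "i < j"
  proof (rule Collect_cong)
    fix e :: "'a set \<times> 'a set"
    have "card (fst e) = j - 1 \<longleftrightarrow> Suc (card (fst e)) = j" using that by linarith
    then show "(e \<in> E \<and> fst e \<in> between S T (j - 1)) = (e \<in> E \<and> snd e \<in> T)"
      using 1[of e] 2(2)[of e] by metis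
  qed
qed

section \<open>Degree counting\<close>

lemma sum_card_swap:
  fixes g :: "'b \<Rightarrow> nat"
  assumes "finite S" "finite W" "\<And>s. s \<in> S \<Longrightarrow> E s \<subseteq> W"
  shows "(\<Sum>s\<in>S. \<Sum>w\<in>E s. g w) = (\<Sum>w\<in>W. card {s\<in>S. w \<in> E s} * g w)"
proof -
  have "(\<Sum>s\<in>S. \<Sum>w\<in>E s. g w) = (\<Sum>s\<in>S. \<Sum>w\<in>W. if w \<in> E s then g w else 0)"
  proof (rule sum.cong[OF refl])
    fix s assume "s \<in> S"
    then have "E s = {w\<in>W. w \<in> E s}" using assms by auto
    then show "(\<Sum>w\<in>E s. g w) = (\<Sum>w\<in>W. if w \<in> E s then g w else 0)"
      using sum.inter_filter[OF assms(2), of g "\<lambda>w. w \<in> E s"] by simp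
  qed
  also have "\<dots> = (\<Sum>w\<in>W. \<Sum>s\<in>S. if w \<in> E s then g w else 0)" by (rule sum.swap)
  also have "\<dots> = (\<Sum>w\<in>W. card {s\<in>S. w \<in> E s} * g w)"
    using assms(1) by (simp add: sum.inter_filter[symmetric])
  finally show ?thesis .
qed

text \<open>
  Here \<open>N\<close> is the neighbourhood of a vertex, \<open>F\<close> the neighbours reached by its flow and \<open>Out w\<close> the
  directions available at \<open>w\<close>. Each such direction leads to another neighbour of the same vertex, and
  one that is counted for both elements of \<open>F\<close> has weight 2.
\<close>

lemma local_degree_count:
  fixes lab :: "'b \<Rightarrow> 'c" and Out :: "'b \<Rightarrow> 'c set" and c :: "'b \<Rightarrow> nat"
  assumes fin: "finite N" and F: "F \<subseteq> N" "card F \<le> 2"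
    and inj: "inj_on lab N"
    and Out: "\<And>w. w \<in> N \<Longrightarrow> Out w \<subseteq> lab ` (N - {w})"
    and sym: "\<And>w w'. w \<in> N \<Longrightarrow> w' \<in> N \<Longrightarrow> lab w' \<in> Out w \<Longrightarrow> lab w \<in> Out w'"
    and heavy: "\<And>w. w \<in> N - F \<Longrightarrow> card (Out w) \<ge> 2 \<Longrightarrow> c w \<ge> 2"
    and pos: "\<And>w. w \<in> N \<Longrightarrow> c w \<ge> 1"
  shows "(\<Sum>w\<in>F. card (Out w)) \<le> sum c N"
    and "card F < 2 \<Longrightarrow> N \<noteq> {} \<Longrightarrow> (\<Sum>w\<in>F. card (Out w)) < sum c N"
proof -
  have finF: "finite F" using F fin finite_subset by blast
  define A where "A = (\<lambda>w. {w' \<in> N - F. lab w' \<in> Out w})"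
  \<comment> \<open>A direction at \<open>w\<close> leads either to a neighbour outside
    \<open>F\<close>, collected in \<open>A w\<close>, or to one of the other
    \<open>card F - 1\<close> elements of \<open>F\<close>.\<close>
  have "card (Out w) \<le> card (A w) + (card F - 1)" if w: "w \<in> F" for w
  proof -
    have "Out w \<subseteq> lab ` (A w \<union> (F - {w}))" using Out[of w] w F by (fastforce simp: A_def)
    then have "card (Out w) \<le> card (lab ` (A w \<union> (F - {w})))"
      by (rule card_mono[rotated]) (use finF fin in \<open>auto simp: A_def\<close>)
    also have "\<dots> \<le> card (A w \<union> (F - {w}))"
      by (rule card_image_le) (use finF fin in \<open>auto simp: A_def\<close>)
    also have "\<dots> \<le> card (A w) + card (F - {w})" by (rule card_Un_le)
    finally show ?thesis using w finF by simp
  qed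
  then have "(\<Sum>w\<in>F. card (Out w)) \<le> (\<Sum>w\<in>F. card (A w) + (card F - 1))" by (rule sum_mono)
  also have "\<dots> = (\<Sum>w\<in>F. \<Sum>w'\<in>A w. 1) + card F * (card F - 1)" by (simp add: sum.distrib)
  also have "(\<Sum>w\<in>F. \<Sum>w'\<in>A w. 1) = (\<Sum>w'\<in>N - F. card {w\<in>F. w' \<in> A w} * 1)"
    by (rule sum_card_swap) (use fin finF in \<open>auto simp: A_def\<close>)
  \<comment> \<open>The elements of \<open>F\<close> that point to \<open>w'\<close> give, by
    \<open>sym\<close> and \<open>inj\<close>, distinct directions at \<open>w'\<close>. If there
    are two of them, \<open>heavy\<close> applies; otherwise \<open>pos\<close> suffices.\<close>
  also have "\<dots> \<le> sum c (N - F)"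
  proof (rule sum_mono)
    fix w' assume w': "w' \<in> N - F"
    let ?B = "{w\<in>F. w' \<in> A w}"
    have le2: "card ?B \<le> card F" by (rule card_mono) (use finF in auto)
    have "lab ` ?B \<subseteq> Out w'" using sym w' F by (auto simp: A_def)
    moreover have "finite (Out w')" using Out[of w'] w' fin finite_subset[of "Out w'"] by auto
    ultimately have "card (lab ` ?B) \<le> card (Out w')" by (intro card_mono)
    moreover have "card (lab ` ?B) = card ?B"
      by (rule card_image) (use inj F in \<open>auto intro: inj_on_subset\<close>)
    ultimately have "card ?B \<le> card (Out w')" by simp
    moreover have "c w' \<ge> 1" using pos w' by auto
    moreover have "c w' \<ge> 2" if "card (Out w') \<ge> 2" using heavy w' that by blast
    ultimately show "card ?B * 1 \<le> c w'" using le2 F(2) by linarith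
  qed
  finally have le: "(\<Sum>w\<in>F. card (Out w)) \<le> sum c (N - F) + card F * (card F - 1)" by simp
  have split: "sum c N = sum c (N - F) + sum c F" using sum.subset_diff[OF F(1) fin] .
  have "(\<Sum>w\<in>F. 1) \<le> sum c F" using pos F by (intro sum_mono) auto
  then have cF: "card F \<le> sum c F" by simp
  \<comment> \<open>Since \<open>card F \<le> 2\<close>, the product
    \<open>card F * (card F - 1)\<close> is at most \<open>card F\<close>, which the weights on
    \<open>F\<close> cover. For \<open>card F = 1\<close> the product is 0, and this gives
    strictness.\<close>
  have "card F = 0 \<or> card F = 1 \<or> card F = 2" using F(2) by linarith
  then show "(\<Sum>w\<in>F. card (Out w)) \<le> sum c N" using le split cF by auto
  assume "card F < 2" "N \<noteq> {}"
  show "(\<Sum>w\<in>F. card (Out w)) < sum c N"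
  proof (cases "card F = 0")
    case True
    obtain w where "w \<in> N" using \<open>N \<noteq> {}\<close> by blast
    then have "c w \<le> sum c N" "c w \<ge> 1" using fin pos by (auto intro: member_le_sum)
    then show ?thesis using True finF by simp
  next
    case False
    then have "card F = 1" using \<open>card F < 2\<close> by linarith
    then show ?thesis using le split cF by simp
  qed
qed

text \<open>The local inequality is summed over \<open>S\<close>; exchanging the order of summation
  turns both sides into sums over \<open>W\<close> weighted by the load \<open>c\<close>. The vertex
  \<open>s0\<close>, with fewer than two flow edges, makes the result strict. The abstract form
  serves both the bottom level and, upside down, the top level.\<close>

lemma degree_count:
  fixes nb E :: "'a \<Rightarrow> 'b set" and lab :: "'a \<Rightarrow> 'b \<Rightarrow> 'c" and Out :: "'b \<Rightarrow> 'c set" and c :: "'b \<Rightarrow> nat"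
  assumes fin: "finite S" "finite W"
    and nb: "\<And>s. s \<in> S \<Longrightarrow> nb s \<subseteq> W"
    and E: "\<And>s. s \<in> S \<Longrightarrow> E s \<subseteq> nb s" "\<And>s. s \<in> S \<Longrightarrow> card (E s) \<le> 2"
    and s0: "s0 \<in> S" "card (E s0) < 2" "nb s0 \<noteq> {}"
    and inj: "\<And>s. s \<in> S \<Longrightarrow> inj_on (lab s) (nb s)"
    and Out: "\<And>s w. s \<in> S \<Longrightarrow> w \<in> nb s \<Longrightarrow> Out w \<subseteq> lab s ` (nb s - {w})"
    and sym: "\<And>s w w'. s \<in> S \<Longrightarrow> w \<in> nb s \<Longrightarrow> w' \<in> nb s \<Longrightarrow> lab s w' \<in> Out w \<Longrightarrow> lab s w \<in> Out w'"
    and heavy: "\<And>s w. s \<in> S \<Longrightarrow> w \<in> nb s - E s \<Longrightarrow> card (Out w) \<ge> 2 \<Longrightarrow> c w \<ge> 2"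
    and pos: "\<And>w. w \<in> W \<Longrightarrow> c w \<ge> 1"
    and c: "\<And>w. w \<in> W \<Longrightarrow> c w = card {s\<in>S. w \<in> E s}"
  shows "(\<Sum>w\<in>W. c w * card (Out w)) < (\<Sum>w\<in>W. c w * card {s\<in>S. w \<in> nb s})"
proof -
  have loc: "(\<Sum>w\<in>E s. card (Out w)) \<le> sum c (nb s)"
      "card (E s) < 2 \<Longrightarrow> nb s \<noteq> {} \<Longrightarrow> (\<Sum>w\<in>E s. card (Out w)) < sum c (nb s)" if s: "s \<in> S" for s
  proof -
    have "finite (nb s)" using nb[OF s] fin finite_subset by blast
    note * = local_degree_count[OF this E[OF s] inj[OF s] Out[OF s] sym[OF s] heavy[OF s]]
    show "(\<Sum>w\<in>E s. card (Out w)) \<le> sum c (nb s)"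
      by (rule *(1)) (use nb[OF s] pos in auto)
    show "card (E s) < 2 \<Longrightarrow> nb s \<noteq> {} \<Longrightarrow> (\<Sum>w\<in>E s. card (Out w)) < sum c (nb s)"
      by (rule *(2)) (use nb[OF s] pos in auto)
  qed
  have "(\<Sum>w\<in>W. c w * card (Out w)) = (\<Sum>w\<in>W. card {s\<in>S. w \<in> E s} * card (Out w))"
    using c by (intro sum.cong) auto
  also have "\<dots> = (\<Sum>s\<in>S. \<Sum>w\<in>E s. card (Out w))"
    by (rule sum_card_swap[symmetric]) (use fin nb E in blast)+
  also have "\<dots> < (\<Sum>s\<in>S. sum c (nb s))"
    by (rule sum_strict_mono_ex1) (use fin loc s0 in auto)
  also have "\<dots> = (\<Sum>w\<in>W. card {s\<in>S. w \<in> nb s} * c w)"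
    by (rule sum_card_swap) (use fin nb in auto)
  finally show ?thesis by (simp add: mult.commute)
qed

section \<open>Directions at a vertex between sources and sinks\<close>

lemma card_Suc_insert:
  assumes "x \<subseteq> y" "finite y" "card y = Suc (card x)"
  obtains f where "f \<notin> x" "y = insert f x"
proof -
  have "card (y - x) = 1" using assms by (simp add: card_Diff_subset finite_subset)
  then obtain f where "y - x = {f}" by (auto simp: card_1_singleton_iff)
  then show thesis using that[of f] assms(1) by blast
qed

lemma finite_up_dirs: "uniform j T \<Longrightarrow> finite (up_dirs T w)"
proof -
  assume T: "uniform j T"
  have "up_dirs T w \<subseteq> \<Union>T" by (auto simp: up_dirs_def)
  then show ?thesis using uniformD(1,2)[OF T] finite_subset by blast
qed

lemma finite_down_dirs: "finite w \<Longrightarrow> finite (down_dirs S w)"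
  by (simp add: down_dirs_def)

lemma between_dirs_pos:
  assumes S: "uniform i S" and T: "uniform j T" and "i < q" "q < j" and w: "w \<in> between S T q"
  shows "card (up_dirs T w) \<ge> 1" "card (down_dirs S w) \<ge> 1"
proof -
  have fw: "finite w" and cw: "card w = q" using uniformD(2,3)[OF uniform_between[OF T]] w by auto
  obtain s t where st: "s \<in> S" "t \<in> T" "s \<subseteq> w" "w \<subseteq> t" using w by (auto simp: between_def)
  then have "s \<noteq> w" "w \<noteq> t" using uniformD(3)[OF S] uniformD(3)[OF T] cw assms by auto
  then obtain e f where "e \<in> w" "e \<notin> s" "f \<in> t" "f \<notin> w" using st by blast
  then have "e \<in> down_dirs S w" "f \<in> up_dirs T w"
    using st unfolding down_dirs_def up_dirs_def by blast+
  then show "card (up_dirs T w) \<ge> 1" "card (down_dirs S w) \<ge> 1"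
    using finite_up_dirs[OF T, of w] finite_down_dirs[OF fw, of S]
    by (metis One_nat_def Suc_leI card_gt_0_iff empty_iff)+
qed

text \<open>One level above \<open>S\<close>, a set \<open>w - {e}\<close> that contains a source
  has the size of that source and so equals it; removing \<open>e\<close> is thus a bijection from
  directions to sources.\<close>

lemma card_down_dirs:
  assumes S: "uniform i S" and w: "finite w" "card w = Suc i"
  shows "card {s\<in>S. s \<subseteq> w} = card (down_dirs S w)"
proof -
  have "bij_betw (\<lambda>e. w - {e}) (down_dirs S w) {s\<in>S. s \<subseteq> w}"
  proof (rule bij_betw_imageI)
    show "inj_on (\<lambda>e. w - {e}) (down_dirs S w)" by (auto simp: inj_on_def down_dirs_def)
    have "w - {e} \<in> S" if "e \<in> w" "s \<in> S" "s \<subseteq> w - {e}" for e s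
    proof -
      have "s = w - {e}" using that w uniformD(3)[OF S] by (intro card_subset_eq) auto
      then show ?thesis using that by simp
    qed
    moreover have "\<exists>e\<in>down_dirs S w. s = w - {e}" if s: "s \<in> S" "s \<subseteq> w" for s
    proof -
      have "card w = Suc (card s)" using uniformD(3)[OF S s(1)] w by simp
      then obtain e where e: "e \<notin> s" "w = insert e s" using card_Suc_insert[OF s(2) w(1)] by blast
      then have "e \<in> down_dirs S w" "s = w - {e}" using s by (auto simp: down_dirs_def)
      then show ?thesis by blast
    qed
    ultimately show "(\<lambda>e. w - {e}) ` down_dirs S w = {s\<in>S. s \<subseteq> w}"
      by (auto simp: down_dirs_def image_iff)
  qed
  then show ?thesis by (rule bij_betw_same_card[symmetric])
qed

lemma card_up_dirs:
  assumes T: "uniform j T" and w: "finite w" "Suc (card w) = j"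
  shows "card {t\<in>T. w \<subseteq> t} = card (up_dirs T w)"
proof -
  have "bij_betw (\<lambda>f. insert f w) (up_dirs T w) {t\<in>T. w \<subseteq> t}"
  proof (rule bij_betw_imageI)
    show "inj_on (\<lambda>f. insert f w) (up_dirs T w)" by (auto simp: inj_on_def up_dirs_def)
    have "insert f w \<in> T" if "f \<notin> w" "t \<in> T" "insert f w \<subseteq> t" for f t
    proof -
      have "insert f w = t" using that w uniformD(2,3)[OF T] by (intro card_subset_eq) auto
      then show ?thesis using that by simp
    qed
    moreover have "\<exists>f\<in>up_dirs T w. t = insert f w" if t: "t \<in> T" "w \<subseteq> t" for t
    proof -
      have "card t = Suc (card w)" using uniformD(3)[OF T t(1)] w by simp
      then obtain f where f: "f \<notin> w" "t = insert f w"
        using card_Suc_insert[OF t(2) uniformD(2)[OF T t(1)]] by blast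
      then have "f \<in> up_dirs T w" using t by (auto simp: up_dirs_def)
      then show ?thesis using f by blast
    qed
    ultimately show "(\<lambda>f. insert f w) ` up_dirs T w = {t\<in>T. w \<subseteq> t}"
      by (auto simp: up_dirs_def image_iff)
  qed
  then show ?thesis by (rule bij_betw_same_card[symmetric])
qed

text \<open>An instance of \<open>degree_count\<close> in which the neighbours of a source are
  labelled by the added element. The saturation hypothesis \<open>sat\<close> makes all loads
  positive and provides the condition on heavy vertices.\<close>

lemma bottom_count:
  assumes F: "layered_flow i j S T k l E" and S: "uniform i S" and T: "uniform j T"
    and ij: "Suc i < j" and k: "\<And>s. s \<in> S \<Longrightarrow> k s \<le> 2"
    and s0: "s0 \<in> S" "k s0 < 2" "t0 \<in> T" "s0 \<subseteq> t0"
    and sat: "\<And>w. w \<in> between S T (Suc i) \<Longrightarrow>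
      min 2 (min (card (down_dirs S w)) (card (up_dirs T w))) \<le> card (E\<inverse> `` {w})"
  shows "(\<Sum>w\<in>between S T (Suc i). card (E\<inverse> `` {w}) * card (up_dirs T w))
       < (\<Sum>w\<in>between S T (Suc i). card (E\<inverse> `` {w}) * card (down_dirs S w))"
proof -
  let ?W = "between S T (Suc i)"
  note FD = layered_flowD[OF F] and FE = layered_flow_ends[OF F S T]
  note W = uniformD[OF uniform_between[OF T, of "Suc i" S]]
  define nb where "nb = (\<lambda>s. {w\<in>?W. s \<subseteq> w})"
  define lab where "lab = (\<lambda>s w. the_elem (w - s :: 'a set))"
  have lab: "lab s (insert f s) = f" if "f \<notin> s" for f s
  proof -
    have "insert f s - s = {f}" using that by auto
    then show ?thesis by (simp add: lab_def)
  qed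
  have nbE: "\<exists>f. f \<notin> s \<and> w = insert f s" if "s \<in> S" "w \<in> nb s" for s w
    using card_Suc_insert[of s w] W(2,3)[of w] uniformD(3)[OF S] that unfolding nb_def by (metis (no_types, lifting) mem_Collect_eq)
  have nbI: "insert f s \<in> nb s" if "s \<in> S" "f \<notin> s" "t \<in> T" "insert f s \<subseteq> t" for f s t
    using that uniformD(2,3)[OF S] unfolding nb_def between_def by auto
  have pred: "E\<inverse> `` {w} = {s\<in>S. w \<in> E `` {s}}" if "w \<in> ?W" for w
  proof -
    have "s \<in> S" if "(s, w) \<in> E" for s
      using FE(1)[OF that] FD(3)[OF that] W(3)[OF \<open>w \<in> ?W\<close>] by simp
    then show ?thesis by auto
  qed
  have pos: "1 \<le> card (E\<inverse> `` {w})" if "w \<in> ?W" for w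
    using sat[OF that] between_dirs_pos[OF S T _ ij that] by simp
  have "(\<Sum>w\<in>?W. card (E\<inverse> `` {w}) * card (up_dirs T w)) < (\<Sum>w\<in>?W. card (E\<inverse> `` {w}) * card {s\<in>S. w \<in> nb s})"
  proof (rule degree_count[where lab = lab and E = "\<lambda>s. E `` {s}"])
    show "finite S" "finite ?W" "s0 \<in> S" using uniformD(1)[OF S] W(1) s0 by auto
    show "nb s \<subseteq> ?W" for s by (auto simp: nb_def)
    show "E `` {s} \<subseteq> nb s" if "s \<in> S" for s
    proof
      fix w assume "w \<in> E `` {s}"
      then have e: "(s, w) \<in> E" by simp
      then show "w \<in> nb s" using FD(2,3)[OF e] FE(4)[OF e] uniformD(3)[OF S that] by (simp add: nb_def)
    qed
    show "card (E `` {s}) \<le> 2" if "s \<in> S" for s using FD(8) k that by simp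
    show "card (E `` {s0}) < 2" using FD(8) s0 by simp
    show "nb s0 \<noteq> {}"
    proof -
      have "s0 \<noteq> t0" using uniformD(3)[OF S s0(1)] uniformD(3)[OF T s0(3)] ij by auto
      then obtain f where "f \<in> t0" "f \<notin> s0" using s0 by blast
      then show ?thesis using nbI[of s0 f t0] s0 by auto
    qed
    show "inj_on (lab s) (nb s)" if "s \<in> S" for s
    proof (rule inj_onI)
      fix w w' assume "w \<in> nb s" "w' \<in> nb s" "lab s w = lab s w'"
      then show "w = w'" using nbE[OF that, of w] nbE[OF that, of w'] lab by metis
    qed
    show "up_dirs T w \<subseteq> lab s ` (nb s - {w})" if s: "s \<in> S" and w: "w \<in> nb s" for s w
    proof
      fix f assume f: "f \<in> up_dirs T w"
      obtain e where e: "e \<notin> s" "w = insert e s" using nbE[OF s w] by blast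
      obtain t where t: "f \<notin> w" "t \<in> T" "insert f w \<subseteq> t" using f by (auto simp: up_dirs_def)
      then have "insert f s \<in> nb s - {w}" using nbI[OF s, of f t] e by auto
      moreover have "lab s (insert f s) = f" using lab t e by auto
      ultimately show "f \<in> lab s ` (nb s - {w})" by force
    qed
    \<comment> \<open>With \<open>w = insert e s\<close> and \<open>w' = insert f s\<close>, both
      memberships say that \<open>s\<close> together with \<open>e\<close> and \<open>f\<close> lies
      below a sink.\<close>
    show "lab s w \<in> up_dirs T w'" if s: "s \<in> S" and w: "w \<in> nb s" "w' \<in> nb s" and l: "lab s w' \<in> up_dirs T w" for s w w'
    proof -
      obtain e f where "e \<notin> s" "w = insert e s" "f \<notin> s" "w' = insert f s"
        using nbE[OF s w(1)] nbE[OF s w(2)] by blast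
      then show ?thesis using l lab[of e s] lab[of f s] by (auto simp: up_dirs_def)
    qed
    show "1 \<le> card (E\<inverse> `` {w})" "card (E\<inverse> `` {w}) = card {s\<in>S. w \<in> E `` {s}}" if "w \<in> ?W" for w
      using pos[OF that] pred[OF that] by auto
    \<comment> \<open>If the load were 1 although two directions lead up, saturation would leave a
      single direction down, so \<open>s\<close> would be the only source below \<open>w\<close>.
      The load of \<open>w\<close> would then come from \<open>s\<close>, which is excluded.\<close>
    show "2 \<le> card (E\<inverse> `` {w})" if s: "s \<in> S" and w: "w \<in> nb s - E `` {s}" and h: "2 \<le> card (up_dirs T w)" for s w
    proof (rule ccontr)
      assume neg: "\<not> 2 \<le> card (E\<inverse> `` {w})"
      have wW: "w \<in> ?W" using w by (simp add: nb_def)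
      have le1: "card (down_dirs S w) \<le> 1" using sat[OF wW] neg h by linarith
      have "E\<inverse> `` {w} \<noteq> {}" using pos[OF wW] by (metis card.empty not_one_le_zero)
      then obtain s' where s': "(s', w) \<in> E" "s' \<in> S" using pred[OF wW] by auto
      then have "s' \<in> {s\<in>S. s \<subseteq> w}" "s \<in> {s\<in>S. s \<subseteq> w}" using FD(2) s w by (auto simp: nb_def)
      moreover have "card {s\<in>S. s \<subseteq> w} \<le> 1"
        using card_down_dirs[OF S W(2)[OF wW] W(3)[OF wW]] le1 by simp
      moreover have "finite {s\<in>S. s \<subseteq> w}" using uniformD(1)[OF S] by simp
      ultimately have "s' = s" by (metis (no_types, lifting) One_nat_def card_le_Suc0_iff_eq)
      then show False using s' w by auto
    qed
  qed
  also have "(\<Sum>w\<in>?W. card (E\<inverse> `` {w}) * card {s\<in>S. w \<in> nb s}) = (\<Sum>w\<in>?W. card (E\<inverse> `` {w}) * card (down_dirs S w))"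
  proof (rule sum.cong[OF refl])
    fix w assume w: "w \<in> ?W"
    then have "{s\<in>S. w \<in> nb s} = {s\<in>S. s \<subseteq> w}" by (auto simp: nb_def)
    then show "card (E\<inverse> `` {w}) * card {s\<in>S. w \<in> nb s} = card (E\<inverse> `` {w}) * card (down_dirs S w)"
      using card_down_dirs[OF S W(2)[OF w] W(3)[OF w]] by simp
  qed
  finally show ?thesis .
qed

text \<open>The order dual of \<open>bottom_count\<close>: the neighbours of a sink are labelled by
  the deleted element, and loads are read as out-degrees.\<close>

lemma top_count:
  assumes F: "layered_flow i j S T k l E" and S: "uniform i S" and T: "uniform j T"
    and ij: "Suc i < j" and l: "\<And>t. t \<in> T \<Longrightarrow> l t \<le> 2"
    and t0: "t0 \<in> T" "l t0 < 2" "s0 \<in> S" "s0 \<subseteq> t0"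
    and sat: "\<And>w. w \<in> between S T (j - 1) \<Longrightarrow>
      min 2 (min (card (down_dirs S w)) (card (up_dirs T w))) \<le> card (E `` {w})"
  shows "(\<Sum>w\<in>between S T (j - 1). card (E `` {w}) * card (down_dirs S w))
       < (\<Sum>w\<in>between S T (j - 1). card (E `` {w}) * card (up_dirs T w))"
proof -
  let ?W = "between S T (j - 1)"
  note FD = layered_flowD[OF F] and FE = layered_flow_ends[OF F S T]
  note W = uniformD[OF uniform_between[OF T, of "j - 1" S]]
  have W3: "Suc (card w) = j" if "w \<in> ?W" for w using W(3)[OF that] ij by simp
  define nb where "nb = (\<lambda>t. {w\<in>?W. w \<subseteq> t})"
  define lab where "lab = (\<lambda>t w. the_elem (t - w :: 'a set))"
  have lab: "lab t (t - {f}) = f" if "f \<in> t" for f t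
  proof -
    have "t - (t - {f}) = {f}" using that by auto
    then show ?thesis by (simp add: lab_def)
  qed
  have nbE: "\<exists>f. f \<in> t \<and> w = t - {f}" if t: "t \<in> T" "w \<in> nb t" for t w
  proof -
    have w: "w \<subseteq> t" "w \<in> ?W" using t by (auto simp: nb_def)
    have "card t = Suc (card w)" using W3[OF w(2)] uniformD(3)[OF T t(1)] by simp
    then obtain f where "f \<notin> w" "t = insert f w"
      using card_Suc_insert[OF w(1) uniformD(2)[OF T t(1)]] by blast
    then show ?thesis by auto
  qed
  have nbI: "t - {f} \<in> nb t" if "t \<in> T" "f \<in> t" "s \<in> S" "s \<subseteq> t - {f}" for f s t
    using that uniformD(2,3)[OF T] unfolding nb_def between_def by auto
  have succ: "E `` {w} = {t\<in>T. w \<in> E\<inverse> `` {t}}" if "w \<in> ?W" for w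
  proof -
    have "t \<in> T" if "(w, t) \<in> E" for t
      using FE(2)[OF that] FD(3)[OF that] W3[OF \<open>w \<in> ?W\<close>] by simp
    then show ?thesis by auto
  qed
  have pos: "1 \<le> card (E `` {w})" if "w \<in> ?W" for w
  proof -
    have "i < j - 1" "j - 1 < j" using ij by auto
    then show ?thesis using sat[OF that] between_dirs_pos[OF S T _ _ that] by simp
  qed
  have "(\<Sum>w\<in>?W. card (E `` {w}) * card (down_dirs S w)) < (\<Sum>w\<in>?W. card (E `` {w}) * card {t\<in>T. w \<in> nb t})"
  proof (rule degree_count[where lab = lab and E = "\<lambda>t. E\<inverse> `` {t}"])
    show "finite T" "finite ?W" "t0 \<in> T" using uniformD(1)[OF T] W(1) t0 by auto
    show "nb t \<subseteq> ?W" for t by (auto simp: nb_def)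
    show "E\<inverse> `` {t} \<subseteq> nb t" if "t \<in> T" for t
    proof
      fix w assume "w \<in> E\<inverse> `` {t}"
      then have e: "(w, t) \<in> E" by simp
      have "card w = j - 1" using FD(3)[OF e] uniformD(3)[OF T that] by simp
      then show "w \<in> nb t" using FD(2)[OF e] FE(4)[OF e] by (simp add: nb_def)
    qed
    show "card (E\<inverse> `` {t}) \<le> 2" if "t \<in> T" for t using FD(9) l that by simp
    show "card (E\<inverse> `` {t0}) < 2" using FD(9) t0 by simp
    show "nb t0 \<noteq> {}"
    proof -
      have "s0 \<noteq> t0" using uniformD(3)[OF S t0(3)] uniformD(3)[OF T t0(1)] ij by auto
      then obtain f where "f \<in> t0" "f \<notin> s0" using t0 by blast
      then show ?thesis using nbI[of t0 f s0] t0 by auto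
    qed
    show "inj_on (lab t) (nb t)" if "t \<in> T" for t
    proof (rule inj_onI)
      fix w w' assume "w \<in> nb t" "w' \<in> nb t" "lab t w = lab t w'"
      then show "w = w'" using nbE[OF that, of w] nbE[OF that, of w'] lab by metis
    qed
    show "down_dirs S w \<subseteq> lab t ` (nb t - {w})" if t: "t \<in> T" and w: "w \<in> nb t" for t w
    proof
      fix f assume f: "f \<in> down_dirs S w"
      obtain e where e: "e \<in> t" "w = t - {e}" using nbE[OF t w] by blast
      obtain s where s: "f \<in> w" "s \<in> S" "s \<subseteq> w - {f}" using f by (auto simp: down_dirs_def)
      then have "t - {f} \<in> nb t - {w}" using nbI[OF t, of f s] e by auto
      moreover have "lab t (t - {f}) = f" using lab s e by auto
      ultimately show "f \<in> lab t ` (nb t - {w})" by force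
    qed
    show "lab t w \<in> down_dirs S w'" if t: "t \<in> T" and w: "w \<in> nb t" "w' \<in> nb t" and l: "lab t w' \<in> down_dirs S w" for t w w'
    proof -
      obtain e f where "e \<in> t" "w = t - {e}" "f \<in> t" "w' = t - {f}"
        using nbE[OF t w(1)] nbE[OF t w(2)] by blast
      then show ?thesis using l lab[of e t] lab[of f t] by (auto simp: down_dirs_def)
    qed
    show "1 \<le> card (E `` {w})" "card (E `` {w}) = card {t\<in>T. w \<in> E\<inverse> `` {t}}" if "w \<in> ?W" for w
      using pos[OF that] succ[OF that] by auto
    show "2 \<le> card (E `` {w})" if t: "t \<in> T" and w: "w \<in> nb t - E\<inverse> `` {t}" and h: "2 \<le> card (down_dirs S w)" for t w
    proof (rule ccontr)
      assume neg: "\<not> 2 \<le> card (E `` {w})"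
      have wW: "w \<in> ?W" using w by (simp add: nb_def)
      have le1: "card (up_dirs T w) \<le> 1" using sat[OF wW] neg h by linarith
      have "E `` {w} \<noteq> {}" using pos[OF wW] by (metis card.empty not_one_le_zero)
      then obtain t' where t': "(w, t') \<in> E" "t' \<in> T" using succ[OF wW] by auto
      then have "t' \<in> {t\<in>T. w \<subseteq> t}" "t \<in> {t\<in>T. w \<subseteq> t}" using FD(2) t w by (auto simp: nb_def)
      moreover have "card {t\<in>T. w \<subseteq> t} \<le> 1"
        using card_up_dirs[OF T W(2)[OF wW] W3[OF wW]] le1 by simp
      moreover have "finite {t\<in>T. w \<subseteq> t}" using uniformD(1)[OF T] by simp
      ultimately have "t' = t" by (metis (no_types, lifting) One_nat_def card_le_Suc0_iff_eq)
      then show False using t' w by auto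
    qed
  qed
  also have "(\<Sum>w\<in>?W. card (E `` {w}) * card {t\<in>T. w \<in> nb t}) = (\<Sum>w\<in>?W. card (E `` {w}) * card (up_dirs T w))"
  proof (rule sum.cong[OF refl])
    fix w assume w: "w \<in> ?W"
    then have "{t\<in>T. w \<in> nb t} = {t\<in>T. w \<subseteq> t}" by (auto simp: nb_def)
    then show "card (E `` {w}) * card {t\<in>T. w \<in> nb t} = card (E `` {w}) * card (up_dirs T w)"
      using card_up_dirs[OF T W(2)[OF w] W3[OF w]] by simp
  qed
  finally show ?thesis .
qed

text \<open>Both sides are sums over the edges from level \<open>q\<close> to the next, weighted at
  the tail and at the head. Conservation at level \<open>q\<close> allows the tails to be counted by
  in-degree.\<close>

lemma flow_weight_mono:
  fixes g h :: "'a set \<Rightarrow> nat"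
  assumes F: "layered_flow i j S T k l E" and S: "uniform i S" and T: "uniform j T"
    and q: "i < q" "q < j"
    and mono: "\<And>x y. (x, y) \<in> E \<Longrightarrow> g x \<le> h y"
  shows "(\<Sum>w\<in>between S T q. card (E\<inverse> `` {w}) * g w) \<le> (\<Sum>w\<in>between S T (Suc q). card (E\<inverse> `` {w}) * h w)"
proof -
  note FD = layered_flowD[OF F] and W = uniformD[OF uniform_between[OF T]]
  have "(\<Sum>w\<in>between S T q. card (E\<inverse> `` {w}) * g w) = (\<Sum>w\<in>between S T q. card (E `` {w}) * g w)"
    using FD(10) W(3) q by (intro sum.cong) auto
  also have "\<dots> = (\<Sum>e\<in>{e\<in>E. fst e \<in> between S T q}. g (fst e))"
    by (rule sum_out_degree[OF FD(1) W(1)])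
  also have "\<dots> \<le> (\<Sum>e\<in>{e\<in>E. snd e \<in> between S T (Suc q)}. h (snd e))"
    unfolding layered_flow_edges(1)[OF F S T] using mono by (intro sum_mono) auto
  also have "\<dots> = (\<Sum>w\<in>between S T (Suc q). card (E\<inverse> `` {w}) * h w)"
    by (rule sum_in_degree[OF FD(1) W(1), symmetric])
  finally show ?thesis .
qed

lemma flow_weight_antimono:
  fixes g h :: "'a set \<Rightarrow> nat"
  assumes F: "layered_flow i j S T k l E" and S: "uniform i S" and T: "uniform j T"
    and q: "i < q" "q < j"
    and mono: "\<And>x y. (x, y) \<in> E \<Longrightarrow> g x \<ge> h y"
  shows "(\<Sum>w\<in>between S T q. card (E\<inverse> `` {w}) * g w) \<ge> (\<Sum>w\<in>between S T (Suc q). card (E\<inverse> `` {w}) * h w)"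
proof -
  note FD = layered_flowD[OF F] and W = uniformD[OF uniform_between[OF T]]
  have "(\<Sum>w\<in>between S T (Suc q). card (E\<inverse> `` {w}) * h w) = (\<Sum>e\<in>{e\<in>E. snd e \<in> between S T (Suc q)}. h (snd e))"
    by (rule sum_in_degree[OF FD(1) W(1)])
  also have "\<dots> \<le> (\<Sum>e\<in>{e\<in>E. fst e \<in> between S T q}. g (fst e))"
    unfolding layered_flow_edges(1)[OF F S T] using mono by (intro sum_mono) auto
  also have "\<dots> = (\<Sum>w\<in>between S T q. card (E `` {w}) * g w)"
    by (rule sum_out_degree[OF FD(1) W(1), symmetric])
  also have "\<dots> = (\<Sum>w\<in>between S T q. card (E\<inverse> `` {w}) * g w)"
    using FD(10) W(3) q by (intro sum.cong) auto
  finally show ?thesis .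
qed

text \<open>The contradiction is the cycle \<open>I (Suc i) \<le> I (j - 1) < U (j - 1) \<le> U (Suc
  i) < I (Suc i)\<close>. The strict steps are \<open>top_count\<close> and
  \<open>bottom_count\<close>. For \<open>j = i + 2\<close> the two levels coincide and the weak
  steps are equalities.\<close>

lemma flow_not_saturated:
  assumes F: "layered_flow i j S T k l E" and S: "uniform i S" and T: "uniform j T"
    and ij: "Suc i < j" and k: "\<And>s. s \<in> S \<Longrightarrow> k s \<le> 2" and l: "\<And>t. t \<in> T \<Longrightarrow> l t \<le> 2"
    and st: "s0 \<in> S" "k s0 < 2" "t0 \<in> T" "l t0 < 2" "s0 \<subseteq> t0"
    and sat: "\<And>q w. q = Suc i \<or> q = j - 1 \<Longrightarrow> w \<in> between S T q \<Longrightarrow>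
      min 2 (min (card (down_dirs S w)) (card (up_dirs T w))) \<le> card (E\<inverse> `` {w})"
  shows False
proof -
  note FD = layered_flowD[OF F] and FE = layered_flow_ends[OF F S T]
  define I where "I = (\<lambda>q. \<Sum>w\<in>between S T q. card (E\<inverse> `` {w}) * card (down_dirs S w))"
  define U where "U = (\<lambda>q. \<Sum>w\<in>between S T q. card (E\<inverse> `` {w}) * card (up_dirs T w))"
  \<comment> \<open>Along an edge, a direction leading down from \<open>x\<close> also leads down
    from \<open>y\<close>, and a direction leading up from \<open>y\<close> also leads up from
    \<open>x\<close>.\<close>
  have "card (down_dirs S x) \<le> card (down_dirs S y)" if "(x, y) \<in> E" for x y
    using FD(2)[OF that] FE(3)[OF that] by (intro card_mono finite_down_dirs) (auto simp: down_dirs_def)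
  then have stepI: "I q \<le> I (Suc q)" if "i < q" "q < j" for q
    unfolding I_def by (intro flow_weight_mono[OF F S T that])
  have "card (up_dirs T y) \<le> card (up_dirs T x)" if "(x, y) \<in> E" for x y
    using FD(2)[OF that] by (intro card_mono finite_up_dirs[OF T]) (auto simp: up_dirs_def)
  then have stepU: "U (Suc q) \<le> U q" if "i < q" "q < j" for q
    unfolding U_def by (intro flow_weight_antimono[OF F S T that])
  have mono: "I (Suc i) \<le> I (Suc i + n) \<and> U (Suc i + n) \<le> U (Suc i)" if "Suc i + n < j" for n
    using that
  proof (induction n)
    case (Suc n)
    then show ?case using stepI[of "Suc i + n"] stepU[of "Suc i + n"] by simp
  qed simp
  have 1: "I (Suc i) \<le> I (j - 1)" "U (j - 1) \<le> U (Suc i)"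
  proof -
    have "Suc i + (j - 1 - Suc i) = j - 1" using ij by linarith
    then show "I (Suc i) \<le> I (j - 1)" "U (j - 1) \<le> U (Suc i)"
      using mono[of "j - 1 - Suc i"] ij by auto
  qed
  have 2: "U (Suc i) < I (Suc i)"
    unfolding U_def I_def by (rule bottom_count[OF F S T ij k st(1,2,3,5) sat]) auto
  have inout: "card (E `` {w}) = card (E\<inverse> `` {w})" if "w \<in> between S T (j - 1)" for w
    using FD(10)[of w] uniformD(3)[OF uniform_between[OF T] that] ij by simp
  have "(\<Sum>w\<in>between S T (j - 1). card (E `` {w}) * card (down_dirs S w))
       < (\<Sum>w\<in>between S T (j - 1). card (E `` {w}) * card (up_dirs T w))"
    by (rule top_count[OF F S T ij l st(3,4,1,5)]) (use sat inout in auto)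
  then have 3: "I (j - 1) < U (j - 1)" unfolding U_def I_def using inout by simp
  show False using 1 2 3 by linarith
qed

section \<open>Existence of the flow\<close>

text \<open>
  Capacity 2 on non-adjacent pairs amounts to no capacity at all, since vertices have capacity 2;
  between consecutive levels it is the capacity 1 of an edge.
\<close>

definition link :: "'a set \<Rightarrow> 'a set \<Rightarrow> nat" where
  "link x y = (if x \<subseteq> y then if card y = Suc (card x) then 1 else 2 else 0)"

text \<open>The cost of separating \<open>X\<close> from \<open>Y\<close> at \<open>w\<close> in the
  network of \<open>two_stage_transport\<close>, with \<open>link\<close> as the capacity on both
  sides.\<close>

definition cap :: "'a set set \<Rightarrow> 'a set set \<Rightarrow> 'a set \<Rightarrow> nat" where
  "cap X Y w = min 2 (min (\<Sum>x\<in>X. link x w) (\<Sum>y\<in>Y. link w y))"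

section \<open>Loads, capacities and weak duality\<close>

lemma cap_mono:
  assumes "X \<subseteq> X'" "Y \<subseteq> Y'" "finite X'" "finite Y'"
  shows "cap X Y w \<le> cap X' Y' w"
proof -
  have "(\<Sum>x\<in>X. link x w) \<le> (\<Sum>x\<in>X'. link x w)" "(\<Sum>y\<in>Y. link w y) \<le> (\<Sum>y\<in>Y'. link w y)"
    using assms by (auto intro: sum_mono2)
  then show ?thesis unfolding cap_def by linarith
qed

text \<open>Next to the sources the sum is a genuine count of edges; further up, one source below
  \<open>w\<close> already accounts for the whole vertex capacity.\<close>

lemma sum_link_below:
  assumes S: "uniform i S" and w: "card w = q" "i < q"
  shows "q = Suc i \<Longrightarrow> (\<Sum>x\<in>S. link x w) = card {s\<in>S. s \<subseteq> w}"
    and "q \<noteq> Suc i \<Longrightarrow> s \<in> S \<Longrightarrow> s \<subseteq> w \<Longrightarrow> 2 \<le> (\<Sum>x\<in>S. link x w)"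
proof -
  show "(\<Sum>x\<in>S. link x w) = card {s\<in>S. s \<subseteq> w}" if "q = Suc i"
  proof -
    have "(\<Sum>x\<in>S. link x w) = (\<Sum>x\<in>S. if x \<subseteq> w then 1 else 0)"
      using uniformD(3)[OF S] w that by (intro sum.cong) (auto simp: link_def)
    then show ?thesis using uniformD(1)[OF S] by (simp add: sum.inter_filter[symmetric])
  qed
  show "2 \<le> (\<Sum>x\<in>S. link x w)" if "q \<noteq> Suc i" "s \<in> S" "s \<subseteq> w"
  proof -
    have "link s w = 2" using that w uniformD(3)[OF S] by (simp add: link_def)
    then show ?thesis using member_le_sum[of s S "\<lambda>x. link x w"] uniformD(1)[OF S] that by simp
  qed
qed

lemma sum_link_above:
  assumes T: "uniform j T" and w: "card w = q" "q < j"
  shows "Suc q = j \<Longrightarrow> (\<Sum>y\<in>T. link w y) = card {t\<in>T. w \<subseteq> t}"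
    and "Suc q \<noteq> j \<Longrightarrow> t \<in> T \<Longrightarrow> w \<subseteq> t \<Longrightarrow> 2 \<le> (\<Sum>y\<in>T. link w y)"
proof -
  show "(\<Sum>y\<in>T. link w y) = card {t\<in>T. w \<subseteq> t}" if "Suc q = j"
  proof -
    have "(\<Sum>y\<in>T. link w y) = (\<Sum>y\<in>T. if w \<subseteq> y then 1 else 0)"
      using uniformD(3)[OF T] w that by (intro sum.cong) (auto simp: link_def)
    then show ?thesis using uniformD(1)[OF T] by (simp add: sum.inter_filter[symmetric])
  qed
  show "2 \<le> (\<Sum>y\<in>T. link w y)" if "Suc q \<noteq> j" "t \<in> T" "w \<subseteq> t"
  proof -
    have "link w t = 2" using that w uniformD(3)[OF T] by (simp add: link_def)
    then show ?thesis using member_le_sum[of t T "\<lambda>y. link w y"] uniformD(1)[OF T] that by simp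
  qed
qed

text \<open>On a side adjacent to \<open>S\<close> or \<open>T\<close> the flow edges at
  \<open>w\<close> come from distinct sources or go to distinct sinks, which \<open>link\<close>
  counts. On a longer side a single source or sink gives 2, which bounds the load.\<close>

lemma load_le_cap:
  assumes F: "layered_flow i j S T k l E" and S: "uniform i S" and T: "uniform j T"
    and w: "card w = q" "i < q" "q < j"
  shows "card (E\<inverse> `` {w}) \<le> cap S T w"
proof (cases "card (E\<inverse> `` {w}) = 0")
  case False
  note FD = layered_flowD[OF F] and FE = layered_flow_ends[OF F S T]
  have io: "card (E `` {w}) = card (E\<inverse> `` {w})" and le2: "card (E\<inverse> `` {w}) \<le> 2" using FD(10,11) w by auto
  have "E\<inverse> `` {w} \<noteq> {}" "E `` {w} \<noteq> {}" using False io by (metis card.empty)+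
  then obtain x y where x: "(x, w) \<in> E" and y: "(w, y) \<in> E" by auto
  obtain s where s: "s \<in> S" "s \<subseteq> w" using FD(6)[OF x] FD(2)[OF x] by blast
  obtain t where t: "t \<in> T" "w \<subseteq> t" using FD(7)[OF y] FD(2)[OF y] by blast
  have "card (E\<inverse> `` {w}) \<le> (\<Sum>x\<in>S. link x w)"
  proof (cases "q = Suc i")
    case True
    have "E\<inverse> `` {w} \<subseteq> {s\<in>S. s \<subseteq> w}"
    proof
      fix x assume "x \<in> E\<inverse> `` {w}"
      then have e: "(x, w) \<in> E" by simp
      then show "x \<in> {s\<in>S. s \<subseteq> w}" using FD(2,3)[OF e] FE(1)[OF e] w True by simp
    qed
    then have "card (E\<inverse> `` {w}) \<le> card {s\<in>S. s \<subseteq> w}" using uniformD(1)[OF S] by (intro card_mono) auto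
    then show ?thesis using sum_link_below(1)[OF S w(1,2) True] by simp
  next
    case False
    then show ?thesis using sum_link_below(2)[OF S w(1,2) False s] le2 by simp
  qed
  moreover have "card (E `` {w}) \<le> (\<Sum>y\<in>T. link w y)"
  proof (cases "Suc q = j")
    case True
    have "E `` {w} \<subseteq> {t\<in>T. w \<subseteq> t}"
    proof
      fix y assume "y \<in> E `` {w}"
      then have e: "(w, y) \<in> E" by simp
      then show "y \<in> {t\<in>T. w \<subseteq> t}" using FD(2,3)[OF e] FE(2)[OF e] w True by simp
    qed
    then have "card (E `` {w}) \<le> card {t\<in>T. w \<subseteq> t}" using uniformD(1)[OF T] by (intro card_mono) auto
    then show ?thesis using sum_link_above(1)[OF T w(1,3) True] by simp
  next
    case False
    then show ?thesis using sum_link_above(2)[OF T w(1,3) False t] le2 io by simp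
  qed
  ultimately show ?thesis using le2 io unfolding cap_def by simp
qed simp

text \<open>This converts saturation of \<open>cap\<close> into the saturation hypothesis of
  \<open>flow_not_saturated\<close>, which is phrased by directions.\<close>

lemma dirs_le_cap:
  assumes S: "uniform i S" and T: "uniform j T" and q: "i < q" "q < j" and w: "w \<in> between S T q"
  shows "min 2 (min (card (down_dirs S w)) (card (up_dirs T w))) \<le> cap S T w"
proof -
  have fw: "finite w" and cw: "card w = q" using uniformD(2,3)[OF uniform_between[OF T] w] by auto
  obtain s t where st: "s \<in> S" "t \<in> T" "s \<subseteq> w" "w \<subseteq> t" using w by (auto simp: between_def)
  have "min 2 (card (down_dirs S w)) \<le> (\<Sum>x\<in>S. link x w)"
  proof (cases "q = Suc i")
    case True
    then show ?thesis using sum_link_below(1)[OF S cw q(1) True] card_down_dirs[OF S fw] cw by simp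
  next
    case False
    then show ?thesis using sum_link_below(2)[OF S cw q(1) False st(1,3)] by simp
  qed
  moreover have "min 2 (card (up_dirs T w)) \<le> (\<Sum>y\<in>T. link w y)"
  proof (cases "Suc q = j")
    case True
    then show ?thesis using sum_link_above(1)[OF T cw q(2) True] card_up_dirs[OF T fw] cw by simp
  next
    case False
    then show ?thesis using sum_link_above(2)[OF T cw q(2) False st(2,4)] by simp
  qed
  ultimately show ?thesis unfolding cap_def by linarith
qed

text \<open>Edges out of sources are the edges into level \<open>Suc i\<close>, and edges into sinks
  are the edges out of level \<open>j - 1\<close>, where conservation exchanges out-degrees for
  in-degrees.\<close>

lemma total_load:
  assumes F: "layered_flow i j S T k l E" and S: "uniform i S" and T: "uniform j T"
    and ij: "Suc i < j" and kl: "sum k S = sum l T" and q: "q = Suc i \<or> q = j - 1"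
  shows "(\<Sum>w\<in>between S T q. card (E\<inverse> `` {w})) = sum k S"
proof -
  note FD = layered_flowD[OF F]
  have 1: "(\<Sum>w\<in>between S T (Suc i). card (E\<inverse> `` {w})) = sum k S"
    using sum_in_degree[OF FD(1) uniformD(1)[OF uniform_between[OF T, of "Suc i" S]], of "\<lambda>_. 1"] layered_flow_edges(2)[OF F S T]
      sum_out_degree[OF FD(1) uniformD(1)[OF S], of "\<lambda>_. 1"] FD(8) by simp
  have "(\<Sum>w\<in>between S T (j - 1). card (E `` {w})) = sum l T"
    using sum_out_degree[OF FD(1) uniformD(1)[OF uniform_between[OF T, of "j - 1" S]], of "\<lambda>_. 1"] layered_flow_edges(3)[OF F S T]
      sum_in_degree[OF FD(1) uniformD(1)[OF T], of "\<lambda>_. 1"] FD(9) ij by simp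
  moreover have "(\<Sum>w\<in>between S T (j - 1). card (E `` {w})) = (\<Sum>w\<in>between S T (j - 1). card (E\<inverse> `` {w}))"
    using FD(10) uniformD(3)[OF uniform_between[OF T, of "j - 1" S]] ij by (intro sum.cong) auto
  ultimately show ?thesis using 1 q kl by auto
qed

text \<open>Weak duality: a flow between \<open>X\<close> and \<open>Y\<close> alone certifies the
  cut inequality for this pair. Passing from \<open>between X Y q\<close> to
  \<open>between S T q\<close> only adds terms.\<close>

lemma flow_value_le_cap:
  assumes F: "layered_flow i j X Y k l E" and S: "uniform i S" and T: "uniform j T"
    and XY: "X \<subseteq> S" "Y \<subseteq> T"
    and ij: "Suc i < j" and kl: "sum k X = sum l Y" and q: "q = Suc i \<or> q = j - 1"
  shows "sum k X \<le> (\<Sum>w\<in>between S T q. cap X Y w)"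
proof -
  note X = uniform_subset[OF S XY(1)] and Y = uniform_subset[OF T XY(2)]
  note W = uniformD[OF uniform_between[OF Y, of q X]]
  have "sum k X = (\<Sum>w\<in>between X Y q. card (E\<inverse> `` {w}))" using total_load[OF F X Y ij kl q] by simp
  also have "\<dots> \<le> (\<Sum>w\<in>between X Y q. cap X Y w)"
  proof (rule sum_mono)
    fix w assume "w \<in> between X Y q"
    then show "card (E\<inverse> `` {w}) \<le> cap X Y w"
      by (intro load_le_cap[OF F X Y W(3)]) (use q ij in auto)
  qed
  also have "\<dots> \<le> (\<Sum>w\<in>between S T q. cap X Y w)"
    by (rule sum_mono2) (use uniformD(1)[OF uniform_between[OF T]] XY in \<open>auto simp: between_def\<close>)
  finally show ?thesis .
qed

section \<open>The cut condition at one of the two outermost inner levels\<close>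

lemma layered_flow_cong:
  assumes "layered_flow i j S T k l E" "\<And>s. s \<in> S \<Longrightarrow> k s = k' s" "\<And>t. t \<in> T \<Longrightarrow> l t = l' t"
  shows "layered_flow i j S T k' l' E"
proof -
  have "\<forall>s\<in>S. card (E `` {s}) = k' s" "\<forall>t\<in>T. card (E\<inverse> `` {t}) = l' t"
    using layered_flowD(8,9)[OF assms(1)] assms(2,3) by auto
  then show ?thesis using assms(1) unfolding layered_flow_def by blast
qed

lemma sum_prod_mono:
  fixes f :: "'b \<Rightarrow> 'c \<Rightarrow> nat"
  assumes "X \<subseteq> S" "Y \<subseteq> T" "finite S" "finite T"
  shows "(\<Sum>x\<in>X. \<Sum>y\<in>Y. f x y) \<le> (\<Sum>x\<in>S. \<Sum>y\<in>T. f x y)"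
proof -
  have "(\<Sum>x\<in>X. \<Sum>y\<in>Y. f x y) \<le> (\<Sum>x\<in>X. \<Sum>y\<in>T. f x y)" using assms by (intro sum_mono sum_mono2) auto
  also have "\<dots> \<le> (\<Sum>x\<in>S. \<Sum>y\<in>T. f x y)" using assms by (intro sum_mono2) auto
  finally show ?thesis .
qed

lemma full_subsum:
  fixes k :: "'b \<Rightarrow> nat"
  assumes "X \<subseteq> S" "finite S" "sum k S \<le> sum k X" "s \<in> S" "k s > 0"
  shows "s \<in> X"
proof (rule ccontr)
  assume "s \<notin> X"
  have "sum k X < sum k S"
    by (rule sum_strict_mono2[where b = s]) (use assms \<open>s \<notin> X\<close> in auto)
  then show False using assms by simp
qed

text \<open>\<open>IH\<close> expresses minimality in the total demand. It gives a flow, hence the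
  cut inequality by weak duality, for every pair \<open>X\<close>, \<open>Y\<close> that carries
  less than the whole demand. A violation can therefore only come from pairs carrying all of
  it.\<close>

lemma cut_condition:
  fixes f :: "'a set \<Rightarrow> 'a set \<Rightarrow> nat"
  assumes ij: "Suc i < j" and S: "uniform i S" and T: "uniform j T"
    and f: "\<And>s t. s \<in> S \<Longrightarrow> t \<in> T \<Longrightarrow> f s t > 0 \<Longrightarrow> s \<subseteq> t"
    and row: "\<And>s. s \<in> S \<Longrightarrow> (\<Sum>t\<in>T. f s t) \<le> 2" and col: "\<And>t. t \<in> T \<Longrightarrow> (\<Sum>s\<in>S. f s t) \<le> 2"
    and IH: "\<And>S' T' (f' :: 'a set \<Rightarrow> 'a set \<Rightarrow> nat). S' \<subseteq> S \<Longrightarrow> T' \<subseteq> T \<Longrightarrow>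
      (\<And>s t. s \<in> S' \<Longrightarrow> t \<in> T' \<Longrightarrow> f' s t \<le> f s t) \<Longrightarrow>
      (\<Sum>s\<in>S'. \<Sum>t\<in>T'. f' s t) < (\<Sum>s\<in>S. \<Sum>t\<in>T. f s t) \<Longrightarrow>
      \<exists>E. layered_flow i j S' T' (\<lambda>s. \<Sum>t\<in>T'. f' s t) (\<lambda>t. \<Sum>s\<in>S'. f' s t) E"
  obtains q where "q = Suc i \<or> q = j - 1"
    "\<And>X Y. X \<subseteq> S \<Longrightarrow> Y \<subseteq> T \<Longrightarrow> (\<Sum>x\<in>X. \<Sum>y\<in>Y. f x y) \<le> (\<Sum>w\<in>between S T q. cap X Y w)"
proof -
  note fS = uniformD(1)[OF S] and fT = uniformD(1)[OF T]
  let ?M = "\<Sum>s\<in>S. \<Sum>t\<in>T. f s t"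
  define S0 where "S0 = {s\<in>S. (\<Sum>t\<in>T. f s t) > 0}"
  define T0 where "T0 = {t\<in>T. (\<Sum>s\<in>S. f s t) > 0}"
  have sub0: "S0 \<subseteq> S" "T0 \<subseteq> T" by (auto simp: S0_def T0_def)
  note S0 = uniform_subset[OF S sub0(1)] and T0 = uniform_subset[OF T sub0(2)]
  note fS0 = uniformD(1)[OF S0] and fT0 = uniformD(1)[OF T0]
  have swap: "?M = (\<Sum>t\<in>T. \<Sum>s\<in>S. f s t)" by (rule sum.swap)
  have small: "(\<Sum>x\<in>X. \<Sum>y\<in>Y. f x y) \<le> (\<Sum>w\<in>between S T q. cap X Y w)"
    if XY: "X \<subseteq> S" "Y \<subseteq> T" and lt: "(\<Sum>x\<in>X. \<Sum>y\<in>Y. f x y) < ?M" and q: "q = Suc i \<or> q = j - 1" for X Y q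
  proof -
    obtain E where E: "layered_flow i j X Y (\<lambda>s. \<Sum>t\<in>Y. f s t) (\<lambda>t. \<Sum>s\<in>X. f s t) E"
      using IH[OF XY _ lt] by blast
    show ?thesis by (rule flow_value_le_cap[OF E S T XY ij sum.swap q])
  qed
  have big: "(\<Sum>w\<in>between S T q. cap S0 T0 w) < ?M"
    if q: "q = Suc i \<or> q = j - 1" and XY: "X \<subseteq> S" "Y \<subseteq> T"
      and gt: "\<not> (\<Sum>x\<in>X. \<Sum>y\<in>Y. f x y) \<le> (\<Sum>w\<in>between S T q. cap X Y w)" for q X Y
  proof -
    have ge: "?M \<le> (\<Sum>x\<in>X. \<Sum>y\<in>Y. f x y)" using small[OF XY _ q] gt by linarith
    have "(\<Sum>x\<in>X. \<Sum>y\<in>Y. f x y) \<le> (\<Sum>x\<in>X. \<Sum>y\<in>T. f x y)"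
      using XY fT by (intro sum_mono sum_mono2) auto
    then have S0X: "S0 \<subseteq> X"
      using full_subsum[OF XY(1) fS, of "\<lambda>s. \<Sum>t\<in>T. f s t"] ge by (auto simp: S0_def)
    have "(\<Sum>x\<in>X. \<Sum>y\<in>Y. f x y) = (\<Sum>y\<in>Y. \<Sum>x\<in>X. f x y)" by (rule sum.swap)
    also have "\<dots> \<le> (\<Sum>y\<in>Y. \<Sum>x\<in>S. f x y)" using XY fS by (intro sum_mono sum_mono2) auto
    finally have "T0 \<subseteq> Y"
      using full_subsum[OF XY(2) fT, of "\<lambda>t. \<Sum>s\<in>S. f s t"] ge swap by (auto simp: T0_def)
    then have "(\<Sum>w\<in>between S T q. cap S0 T0 w) \<le> (\<Sum>w\<in>between S T q. cap X Y w)"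
      using S0X XY fS fT finite_subset by (intro sum_mono cap_mono) auto
    also have "\<dots> < (\<Sum>x\<in>X. \<Sum>y\<in>Y. f x y)" using gt by simp
    also have "\<dots> \<le> ?M" using sum_prod_mono[OF XY fS fT] .
    finally show ?thesis .
  qed
  define good where "good = (\<lambda>q. \<forall>X Y. X \<subseteq> S \<longrightarrow> Y \<subseteq> T \<longrightarrow>
      (\<Sum>x\<in>X. \<Sum>y\<in>Y. f x y) \<le> (\<Sum>w\<in>between S T q. cap X Y w))"
  have "good (Suc i) \<or> good (j - 1)"
  proof (rule ccontr)
    assume neg: "\<not> ?thesis"
    have lt: "(\<Sum>w\<in>between S T q. cap S0 T0 w) < ?M" if q: "q = Suc i \<or> q = j - 1" for q
    proof -
      have "\<not> good q" using neg q by auto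
      then obtain X Y where XY: "X \<subseteq> S" "Y \<subseteq> T"
        "\<not> (\<Sum>x\<in>X. \<Sum>y\<in>Y. f x y) \<le> (\<Sum>w\<in>between S T q. cap X Y w)"
        unfolding good_def by blast
      show ?thesis by (rule big[OF q XY])
    qed
    have "?M \<noteq> 0" using lt[of "Suc i"] by linarith
    then obtain s0 where s0: "s0 \<in> S" "(\<Sum>t\<in>T. f s0 t) \<noteq> 0" by (meson sum.neutral)
    then obtain t0 where t0: "t0 \<in> T" "f s0 t0 \<noteq> 0" by (meson sum.neutral)
    have "f s0 t0 \<le> (\<Sum>s\<in>S. f s t0)" by (rule member_le_sum[of s0 S "\<lambda>s. f s t0"]) (use s0 fS in auto)
    then have in0: "s0 \<in> S0" "t0 \<in> T0" using s0 t0 by (auto simp: S0_def T0_def)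
    define f' where "f' = (\<lambda>s t. f s t - (if s = s0 \<and> t = t0 then 1 else 0))"
    have row': "(\<Sum>t\<in>T0. f' s t) + (if s = s0 then 1 else 0) = (\<Sum>t\<in>T. f s t)" if "s \<in> S" for s
    proof -
      have "(\<Sum>t\<in>T0. f' s t) + (if s = s0 then 1 else 0) = (\<Sum>t\<in>T0. f' s t + (if s = s0 \<and> t = t0 then 1 else 0))"
        unfolding sum.distrib using in0 fT0 by auto
      also have "\<dots> = (\<Sum>t\<in>T0. f s t)" using t0 by (intro sum.cong) (auto simp: f'_def)
      also have "\<dots> = (\<Sum>t\<in>T. f s t)"
        by (rule sum.mono_neutral_left) (use fT sub0 fS that in \<open>auto simp: T0_def\<close>)
      finally show ?thesis .
    qed
    have col': "(\<Sum>s\<in>S0. f' s t) + (if t = t0 then 1 else 0) = (\<Sum>s\<in>S. f s t)" if "t \<in> T" for t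
    proof -
      have "(\<Sum>s\<in>S0. f' s t) + (if t = t0 then 1 else 0) = (\<Sum>s\<in>S0. f' s t + (if s = s0 \<and> t = t0 then 1 else 0))"
        unfolding sum.distrib using in0 fS0 by auto
      also have "\<dots> = (\<Sum>s\<in>S0. f s t)" using t0 by (intro sum.cong) (auto simp: f'_def)
      also have "\<dots> = (\<Sum>s\<in>S. f s t)"
        by (rule sum.mono_neutral_left) (use fS sub0 fT that in \<open>auto simp: S0_def\<close>)
      finally show ?thesis .
    qed
    have tot: "(\<Sum>s\<in>S0. \<Sum>t\<in>T0. f' s t) + 1 = ?M"
    proof -
      have "(\<Sum>s\<in>S0. \<Sum>t\<in>T0. f' s t) + 1 = (\<Sum>s\<in>S0. (\<Sum>t\<in>T0. f' s t) + (if s = s0 then 1 else 0))"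
        unfolding sum.distrib using in0 fS0 by simp
      also have "\<dots> = (\<Sum>s\<in>S0. \<Sum>t\<in>T. f s t)" using sub0 by (intro sum.cong refl row') auto
      also have "\<dots> = ?M" by (rule sum.mono_neutral_left) (use fS sub0 in \<open>auto simp: S0_def\<close>)
      finally show ?thesis .
    qed
    have "f' s t \<le> f s t" for s t by (simp add: f'_def)
    then obtain E where E: "layered_flow i j S0 T0 (\<lambda>s. \<Sum>t\<in>T0. f' s t) (\<lambda>t. \<Sum>s\<in>S0. f' s t) E"
      using IH[OF sub0, of f'] tot by fastforce
    have sat: "card (E\<inverse> `` {w}) = cap S0 T0 w" if q: "q = Suc i \<or> q = j - 1" and w: "w \<in> between S0 T0 q" for q w
    proof -
      note W = uniformD[OF uniform_between[OF T0, of q S0]]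
      have le: "card (E\<inverse> `` {w}) \<le> cap S0 T0 w" if "w \<in> between S0 T0 q" for w
        by (rule load_le_cap[OF E S0 T0 W(3)[OF that]]) (use q ij in auto)
      have "(\<Sum>w\<in>between S0 T0 q. cap S0 T0 w) \<le> (\<Sum>w\<in>between S T q. cap S0 T0 w)"
        by (rule sum_mono2) (use uniformD(1)[OF uniform_between[OF T]] sub0 in \<open>auto simp: between_def\<close>)
      also have "\<dots> \<le> (\<Sum>s\<in>S0. \<Sum>t\<in>T0. f' s t)" using lt[OF q] tot by linarith
      also have "\<dots> = (\<Sum>w\<in>between S0 T0 q. card (E\<inverse> `` {w}))"
        using total_load[OF E S0 T0 ij sum.swap q] by simp
      finally have "(\<Sum>w\<in>between S0 T0 q. cap S0 T0 w) \<le> \<dots>" .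
      moreover have "(\<Sum>w\<in>between S0 T0 q. card (E\<inverse> `` {w})) \<le> (\<Sum>w\<in>between S0 T0 q. cap S0 T0 w)"
        using le by (rule sum_mono)
      ultimately have "(\<Sum>w\<in>between S0 T0 q. card (E\<inverse> `` {w})) = (\<Sum>w\<in>between S0 T0 q. cap S0 T0 w)"
        by linarith
      then show ?thesis by (rule sum_mono_inv[OF _ le w W(1)])
    qed
    show False
    proof (rule flow_not_saturated[OF E S0 T0 ij _ _ in0(1) _ in0(2)])
      show "(\<Sum>t\<in>T0. f' s t) \<le> 2" if "s \<in> S0" for s
        using row'[of s] row[of s] sub0 that by (auto split: if_splits)
      show "(\<Sum>s\<in>S0. f' s t) \<le> 2" if "t \<in> T0" for t
        using col'[of t] col[of t] sub0 that by (auto split: if_splits)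
      show "(\<Sum>t\<in>T0. f' s0 t) < 2" using row'[OF s0(1)] row[OF s0(1)] by simp
      show "(\<Sum>s\<in>S0. f' s t0) < 2" using col'[OF t0(1)] col[OF t0(1)] by simp
      show "s0 \<subseteq> t0" using f[OF s0(1) t0(1)] t0(2) by simp
      show "min 2 (min (card (down_dirs S0 w)) (card (up_dirs T0 w))) \<le> card (E\<inverse> `` {w})"
        if q: "q = Suc i \<or> q = j - 1" and w: "w \<in> between S0 T0 q" for q w
      proof -
        have "i < q" "q < j" using q ij by auto
        then show ?thesis using dirs_le_cap[OF S0 T0 _ _ w] sat[OF q w] by simp
      qed
    qed
  qed
  then show thesis using that[of "Suc i"] that[of "j - 1"] unfolding good_def by blast
qed

theorem layered_flow_exists:
  fixes f :: "'a set \<Rightarrow> 'a set \<Rightarrow> nat"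
  assumes "Suc i < j" "uniform i S" "uniform j T"
    and "\<And>s t. s \<in> S \<Longrightarrow> t \<in> T \<Longrightarrow> f s t > 0 \<Longrightarrow> s \<subseteq> t"
    and "\<And>s. s \<in> S \<Longrightarrow> (\<Sum>t\<in>T. f s t) \<le> 2" "\<And>t. t \<in> T \<Longrightarrow> (\<Sum>s\<in>S. f s t) \<le> 2"
  shows "\<exists>E. layered_flow i j S T (\<lambda>s. \<Sum>t\<in>T. f s t) (\<lambda>t. \<Sum>s\<in>S. f s t) E"
  using assms
proof (induction "j - i" arbitrary: i j S T f rule: less_induct)
  case (less i j S T f)
  note outer = less.hyps
  note ij = less.prems(1)
  show ?case using less.prems(2-)
  proof (induction "\<Sum>s\<in>S. \<Sum>t\<in>T. f s t" arbitrary: S T f rule: less_induct)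
    case (less S T f)
    note inner = less.hyps
    note S = less.prems(1) and T = less.prems(2) and f = less.prems(3) and row = less.prems(4) and col = less.prems(5)
    note fS = uniformD(1)[OF S] and fT = uniformD(1)[OF T]
    let ?k = "\<lambda>s. \<Sum>t\<in>T. f s t" and ?l = "\<lambda>t. \<Sum>s\<in>S. f s t"
    obtain q where q: "q = Suc i \<or> q = j - 1"
      "\<And>X Y. X \<subseteq> S \<Longrightarrow> Y \<subseteq> T \<Longrightarrow> (\<Sum>x\<in>X. \<Sum>y\<in>Y. f x y) \<le> (\<Sum>w\<in>between S T q. cap X Y w)"
    proof (rule cut_condition[OF ij S T f row col])
      fix S' T' and f' :: "'a set \<Rightarrow> 'a set \<Rightarrow> nat"
      assume sub: "S' \<subseteq> S" "T' \<subseteq> T" and le: "\<And>s t. s \<in> S' \<Longrightarrow> t \<in> T' \<Longrightarrow> f' s t \<le> f s t"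
        and lt: "(\<Sum>s\<in>S'. \<Sum>t\<in>T'. f' s t) < (\<Sum>s\<in>S. \<Sum>t\<in>T. f s t)"
      show "\<exists>E. layered_flow i j S' T' (\<lambda>s. \<Sum>t\<in>T'. f' s t) (\<lambda>t. \<Sum>s\<in>S'. f' s t) E"
      proof (rule inner[OF lt uniform_subset[OF S sub(1)] uniform_subset[OF T sub(2)]])
        show "s \<subseteq> t" if "s \<in> S'" "t \<in> T'" "0 < f' s t" for s t
          using f[of s t] le[of s t] sub that by fastforce
        show "(\<Sum>t\<in>T'. f' s t) \<le> 2" if "s \<in> S'" for s
        proof -
          have "(\<Sum>t\<in>T'. f' s t) \<le> (\<Sum>t\<in>T'. f s t)" using le that by (intro sum_mono) auto
          also have "\<dots> \<le> (\<Sum>t\<in>T. f s t)" using sub fT by (intro sum_mono2) auto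
          finally show ?thesis using row[of s] sub that by fastforce
        qed
        show "(\<Sum>s\<in>S'. f' s t) \<le> 2" if "t \<in> T'" for t
        proof -
          have "(\<Sum>s\<in>S'. f' s t) \<le> (\<Sum>s\<in>S'. f s t)" using le that by (intro sum_mono) auto
          also have "\<dots> \<le> (\<Sum>s\<in>S. f s t)" using sub fS by (intro sum_mono2) auto
          finally show ?thesis using col[of t] sub that by fastforce
        qed
      qed
    qed auto
    have iqj: "i < q" "q < j" using q(1) ij by auto
    let ?W = "between S T q"
    note W = uniform_between[OF T, of q S]
    have "sum ?k X \<le> sum ?l (T - Y) + (\<Sum>w\<in>?W. min 2 (min (\<Sum>x\<in>X. link x w) (\<Sum>y\<in>Y. link w y)))"
      if XY: "X \<subseteq> S" "Y \<subseteq> T" for X Y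
    proof -
      have "sum ?k X = (\<Sum>x\<in>X. (\<Sum>t\<in>T - Y. f x t) + (\<Sum>t\<in>Y. f x t))"
        using sum.subset_diff[OF XY(2) fT] by (intro sum.cong) auto
      also have "\<dots> = (\<Sum>t\<in>T - Y. \<Sum>x\<in>X. f x t) + (\<Sum>x\<in>X. \<Sum>t\<in>Y. f x t)"
        unfolding sum.distrib by (simp add: sum.swap[of _ X])
      also have "(\<Sum>t\<in>T - Y. \<Sum>x\<in>X. f x t) \<le> sum ?l (T - Y)"
        using XY fS by (intro sum_mono sum_mono2) auto
      also have "(\<Sum>x\<in>X. \<Sum>t\<in>Y. f x t) \<le> (\<Sum>w\<in>?W. cap X Y w)" by (rule q(2)[OF XY])
      finally show ?thesis unfolding cap_def by simp
    qed
    then obtain z1 z2 where z: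
      "\<And>s w. s \<in> S \<Longrightarrow> w \<in> ?W \<Longrightarrow> z1 s w \<le> link s w"
      "\<And>w t. w \<in> ?W \<Longrightarrow> t \<in> T \<Longrightarrow> z2 w t \<le> link w t"
      "\<And>s. s \<in> S \<Longrightarrow> (\<Sum>w\<in>?W. z1 s w) = ?k s"
      "\<And>t. t \<in> T \<Longrightarrow> (\<Sum>w\<in>?W. z2 w t) = ?l t"
      "\<And>w. w \<in> ?W \<Longrightarrow> (\<Sum>s\<in>S. z1 s w) = (\<Sum>t\<in>T. z2 w t)"
      "\<And>w. w \<in> ?W \<Longrightarrow> (\<Sum>s\<in>S. z1 s w) \<le> 2"
      using two_stage_transport[OF fS uniformD(1)[OF W] fT sum.swap[of f T S], of link link] by blast
    have part: "\<exists>E. layered_flow a b A B (\<lambda>x. \<Sum>y\<in>B. z x y) (\<lambda>y. \<Sum>x\<in>A. z x y) E"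
      if ab: "a < b" "b - a < j - i" and A: "uniform a A" and B: "uniform b B"
        and zl: "\<And>x y. x \<in> A \<Longrightarrow> y \<in> B \<Longrightarrow> z x y \<le> link x y"
        and zr: "\<And>x. x \<in> A \<Longrightarrow> (\<Sum>y\<in>B. z x y) \<le> 2" "\<And>y. y \<in> B \<Longrightarrow> (\<Sum>x\<in>A. z x y) \<le> 2"
      for a b A B and z :: "'a set \<Rightarrow> 'a set \<Rightarrow> nat"
    proof -
      have incl: "x \<subseteq> y" if "x \<in> A" "y \<in> B" "0 < z x y" for x y
        using zl[OF that(1,2)] that(3) by (auto simp: link_def split: if_splits)
      show ?thesis
      proof (cases "b = Suc a")
        case True
        have "z x y \<le> 1" if "x \<in> A" "y \<in> B" for x y
          using zl[OF that] uniformD(3)[OF A that(1)] uniformD(3)[OF B that(2)] True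
          by (auto simp: link_def split: if_splits)
        then show ?thesis using layered_flow_single[OF A, of B z] B True incl by blast
      next
        case False
        then have "Suc a < b" using ab by simp
        then show ?thesis using outer[OF ab(2) _ A B incl zr] by blast
      qed
    qed
    have dist: "q - i < j - i" "j - q < j - i" using iqj by auto
    obtain E1 where E1: "layered_flow i q S ?W (\<lambda>s. \<Sum>w\<in>?W. z1 s w) (\<lambda>w. \<Sum>s\<in>S. z1 s w) E1"
      using part[of i q S ?W z1] dist iqj S W z row by auto
    obtain E2 where E2: "layered_flow q j ?W T (\<lambda>w. \<Sum>t\<in>T. z2 w t) (\<lambda>t. \<Sum>w\<in>?W. z2 w t) E2"
      using part[of q j ?W T z2] dist iqj T W z col by auto
    have "layered_flow i j S T ?k ?l (E1 \<union> E2)"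
    proof (rule layered_flow_glue[OF _ _ S W T iqj order_refl z(6)])
      show "layered_flow i q S ?W ?k (\<lambda>w. \<Sum>s\<in>S. z1 s w) E1"
        using E1 z(3) refl by (rule layered_flow_cong)
      show "layered_flow q j ?W T (\<lambda>w. \<Sum>s\<in>S. z1 s w) ?l E2"
        using E2 z(5)[symmetric] z(4) by (rule layered_flow_cong)
    qed
    then show ?case by blast
  qed
qed

section \<open>Splitting a flow of capacity two\<close>

definition linkage :: "nat \<Rightarrow> nat \<Rightarrow> 'a set set \<Rightarrow> 'a set set \<Rightarrow> ('a set \<times> 'a set) set \<Rightarrow> bool" where
  "linkage i j S T M \<longleftrightarrow> layered_flow i j S T (\<lambda>_. 1) (\<lambda>_. 1) M \<and>
     (\<forall>v. i < card v \<longrightarrow> card v < j \<longrightarrow> card (M `` {v}) \<le> 1)"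

lemma layered_flow_2_split:
  assumes F: "layered_flow i j S T (\<lambda>_. 2) (\<lambda>_. 2) E" and S: "uniform i S" and T: "uniform j T"
  obtains M where "M \<subseteq> E" "linkage i j S T M" "linkage i j S T (E - M)"
proof -
  note FD = layered_flowD[OF F] and FE = layered_flow_ends[OF F S T]
  have finE: "finite E" by (rule FD(1))
  have finI: "finite (E `` {v})" "finite (E\<inverse> `` {v})" for v using finE by (auto intro: finite_Image)
  let ?L = "Domain E" and ?R = "Range E"
  have fin: "finite ?L" "finite ?R" using finE by (auto simp: finite_Domain finite_Range)
  define u :: "'a set \<Rightarrow> 'a set \<Rightarrow> nat" where
    "u = (\<lambda>v w. (if (v, w) \<in> E then 1 else 0) + (if v = w then (if card (E `` {v}) = 1 then 1 else 0) else 0))"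
  have irr: "(v, v) \<notin> E" for v using FD(3)[of v v] by auto
  have posL: "card (E `` {v}) \<noteq> 0 \<longleftrightarrow> v \<in> ?L" for v using finI(1)[of v] by auto
  have posR: "card (E\<inverse> `` {v}) \<noteq> 0 \<longleftrightarrow> v \<in> ?R" for v using finI(2)[of v] by auto
  have Lcases: "v \<in> S \<or> (i < card v \<and> card v < j)" if v: "v \<in> ?L" for v
  proof -
    obtain y where e: "(v, y) \<in> E" using v by auto
    show ?thesis using FE(1)[OF e] FD(3,4,5)[OF e] by linarith
  qed
  have Rcases: "v \<in> T \<or> (i < card v \<and> card v < j)" if v: "v \<in> ?R" for v
  proof -
    obtain x where e: "(x, v) \<in> E" using v by auto
    show ?thesis using FE(2)[OF e] FD(3,4,5)[OF e] by linarith
  qed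
  have SR: "s \<notin> ?R" if "s \<in> S" for s
  proof
    assume "s \<in> ?R"
    then obtain x where e: "(x, s) \<in> E" by auto
    show False using FD(3,4)[OF e] uniformD(3)[OF S that] by simp
  qed
  have TL: "t \<notin> ?L" if "t \<in> T" for t
  proof
    assume "t \<in> ?L"
    then obtain y where e: "(t, y) \<in> E" by auto
    show False using FD(3,5)[OF e] uniformD(3)[OF T that] by simp
  qed
  have row: "(\<Sum>w\<in>?R. u v w) = 2" if v: "v \<in> ?L" for v
  proof -
    have "(\<Sum>w\<in>?R. if (v, w) \<in> E then 1 else 0) = card {w\<in>?R. (v, w) \<in> E}"
      using fin(2) by (simp add: sum.inter_filter[symmetric])
    also have "{w\<in>?R. (v, w) \<in> E} = E `` {v}" by auto
    finally have "(\<Sum>w\<in>?R. u v w) = card (E `` {v}) + (if v \<in> ?R then (if card (E `` {v}) = 1 then 1 else 0) else 0)"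
      unfolding u_def sum.distrib using fin(2) by (simp only: sum.delta')
    also have "\<dots> = 2"
      using Lcases[OF v]
    proof
      assume "v \<in> S"
      then show ?thesis using FD(8) by simp
    next
      assume c: "i < card v \<and> card v < j"
      then have "v \<in> ?R" using FD(10)[of v] posL[of v] posR[of v] v by simp
      moreover have "card (E `` {v}) \<noteq> 0" using posL v by blast
      moreover have "card (E `` {v}) \<le> 2" using FD(10,11)[of v] c by simp
      ultimately show ?thesis by auto
    qed
    finally show ?thesis .
  qed
  have col: "(\<Sum>v\<in>?L. u v w) = 2" if w: "w \<in> ?R" for w
  proof -
    have "(\<Sum>v\<in>?L. if (v, w) \<in> E then 1 else 0) = card {v\<in>?L. (v, w) \<in> E}"
      using fin(1) by (simp add: sum.inter_filter[symmetric])
    also have "{v\<in>?L. (v, w) \<in> E} = E\<inverse> `` {w}" by auto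
    finally have "(\<Sum>v\<in>?L. u v w) = card (E\<inverse> `` {w}) + (if w \<in> ?L then (if card (E `` {w}) = 1 then 1 else 0) else 0)"
      unfolding u_def sum.distrib using fin(1) by (simp only: sum.delta)
    also have "\<dots> = 2"
      using Rcases[OF w]
    proof
      assume "w \<in> T"
      then show ?thesis using FD(9) TL by simp
    next
      assume c: "i < card w \<and> card w < j"
      then have "w \<in> ?L" using FD(10)[of w] posL[of w] posR[of w] w by simp
      moreover have "card (E\<inverse> `` {w}) \<noteq> 0" using posR w by blast
      moreover have "card (E\<inverse> `` {w}) \<le> 2" "card (E `` {w}) = card (E\<inverse> `` {w})"
        using FD(10,11)[of w] c by simp_all
      ultimately show ?thesis by auto
    qed
    finally show ?thesis .
  qed
  have "\<exists>z. (\<forall>x\<in>?L. \<forall>y\<in>?R. z x y \<le> u x y) \<and> (\<forall>x\<in>?L. (\<Sum>y\<in>?R. z x y) = 1) \<and>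
             (\<forall>y\<in>?R. (\<Sum>x\<in>?L. z x y) \<le> 1)"
  proof (rule transport[OF fin])
    fix X assume X: "X \<subseteq> ?L"
    have "2 * card X = (\<Sum>x\<in>X. \<Sum>y\<in>?R. u x y)" using row X by (simp add: subset_iff)
    also have "\<dots> = (\<Sum>y\<in>?R. \<Sum>x\<in>X. u x y)" by (rule sum.swap)
    also have "\<dots> \<le> (\<Sum>y\<in>?R. 2 * min 1 (\<Sum>x\<in>X. u x y))"
    proof (rule sum_mono)
      fix y assume y: "y \<in> ?R"
      have "(\<Sum>x\<in>X. u x y) \<le> (\<Sum>x\<in>?L. u x y)" using X fin by (intro sum_mono2) auto
      then show "(\<Sum>x\<in>X. u x y) \<le> 2 * min 1 (\<Sum>x\<in>X. u x y)" using col[OF y] by linarith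
    qed
    also have "\<dots> = 2 * (\<Sum>y\<in>?R. min 1 (\<Sum>x\<in>X. u x y))" by (simp add: sum_distrib_left)
    finally show "(\<Sum>x\<in>X. 1) \<le> (\<Sum>y\<in>?R. min 1 (\<Sum>x\<in>X. u x y))" by simp
  qed
  then obtain z where z: "\<And>x y. x \<in> ?L \<Longrightarrow> y \<in> ?R \<Longrightarrow> z x y \<le> u x y"
    "\<And>x. x \<in> ?L \<Longrightarrow> (\<Sum>y\<in>?R. z x y) = 1" "\<And>y. y \<in> ?R \<Longrightarrow> (\<Sum>x\<in>?L. z x y) \<le> 1" by blast
  have "(\<Sum>x\<in>?L. \<Sum>y\<in>?R. u x y) = (\<Sum>y\<in>?R. \<Sum>x\<in>?L. u x y)" by (rule sum.swap)
  then have cardLR: "card ?L = card ?R" using row col by simp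
  have "(\<Sum>y\<in>?R. \<Sum>x\<in>?L. z x y) = (\<Sum>x\<in>?L. \<Sum>y\<in>?R. z x y)" by (rule sum.swap)
  also have "\<dots> = (\<Sum>y\<in>?R. 1)" using z(2) cardLR by simp
  finally have zc: "(\<Sum>x\<in>?L. z x y) = 1" if "y \<in> ?R" for y
    by (rule sum_mono_inv[OF _ z(3) that fin(2)])
  define M where "M = {(x, y). (x, y) \<in> E \<and> z x y = 1}"
  define \<delta> where "\<delta> = (\<lambda>v. if v \<in> ?L \<and> v \<in> ?R then z v v else 0)"
  have ME: "M \<subseteq> E" by (auto simp: M_def)
  have zval: "z v w = (if (v, w) \<in> M then 1 else 0) + (if v = w then z v v else 0)"
    if "v \<in> ?L" "w \<in> ?R" for v w
    using z(1)[OF that] irr[of v] by (auto simp: u_def M_def split: if_splits)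
  have outM: "card (M `` {v}) + \<delta> v = 1" if v: "v \<in> ?L" for v
  proof -
    have "1 = (\<Sum>w\<in>?R. z v w)" using z(2)[OF v] by simp
    also have "\<dots> = (\<Sum>w\<in>?R. (if (v, w) \<in> M then 1 else 0) + (if v = w then z v v else 0))"
      by (rule sum.cong[OF refl zval[OF v]])
    also have "\<dots> = (\<Sum>w\<in>?R. if (v, w) \<in> M then 1 else 0) + \<delta> v"
      unfolding sum.distrib using fin(2) v by (simp add: \<delta>_def)
    also have "(\<Sum>w\<in>?R. if (v, w) \<in> M then 1 else 0) = card {w\<in>?R. (v, w) \<in> M}"
      using fin(2) by (simp add: sum.inter_filter[symmetric])
    also have "{w\<in>?R. (v, w) \<in> M} = M `` {v}" using ME by auto
    finally show ?thesis by simp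
  qed
  have inM: "card (M\<inverse> `` {w}) + \<delta> w = 1" if w: "w \<in> ?R" for w
  proof -
    have "1 = (\<Sum>v\<in>?L. z v w)" using zc[OF w] by simp
    also have "\<dots> = (\<Sum>v\<in>?L. (if (v, w) \<in> M then 1 else 0) + (if v = w then z w w else 0))"
    proof (rule sum.cong[OF refl])
      fix v assume "v \<in> ?L"
      from zval[OF this w] show "z v w = (if (v, w) \<in> M then 1 else 0) + (if v = w then z w w else 0)"
        by (cases "v = w") simp_all
    qed
    also have "\<dots> = (\<Sum>v\<in>?L. if (v, w) \<in> M then 1 else 0) + \<delta> w"
      unfolding sum.distrib using fin(1) w by (simp add: \<delta>_def)
    also have "(\<Sum>v\<in>?L. if (v, w) \<in> M then 1 else 0) = card {v\<in>?L. (v, w) \<in> M}"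
      using fin(1) by (simp add: sum.inter_filter[symmetric])
    also have "{v\<in>?L. (v, w) \<in> M} = M\<inverse> `` {w}" using ME by auto
    finally show ?thesis by simp
  qed
  have \<delta>2: "\<delta> v = 0" if "card (E `` {v}) = 2" for v
    using z(1)[of v v] irr[of v] that by (auto simp: \<delta>_def u_def)
  have diff: "card ((E - M) `` {v}) = card (E `` {v}) - card (M `` {v})"
    "card ((E - M)\<inverse> `` {v}) = card (E\<inverse> `` {v}) - card (M\<inverse> `` {v})" for v
  proof -
    have "(E - M) `` {v} = E `` {v} - M `` {v}" "(E - M)\<inverse> `` {v} = E\<inverse> `` {v} - M\<inverse> `` {v}" by auto
    moreover have "M `` {v} \<subseteq> E `` {v}" "M\<inverse> `` {v} \<subseteq> E\<inverse> `` {v}" using ME by auto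
    ultimately show "card ((E - M) `` {v}) = card (E `` {v}) - card (M `` {v})"
      "card ((E - M)\<inverse> `` {v}) = card (E\<inverse> `` {v}) - card (M\<inverse> `` {v})"
      using finI[of v] by (simp_all add: card_Diff_subset finite_subset)
  qed
  have Sdeg: "card (M `` {s}) = 1 \<and> card ((E - M) `` {s}) = 1" if s: "s \<in> S" for s
  proof -
    have c: "card (E `` {s}) = 2" using FD(8)[OF s] by simp
    then have "s \<in> ?L" using posL[of s] by simp
    then show ?thesis using outM[of s] SR[OF s] diff(1)[of s] c by (simp add: \<delta>_def)
  qed
  have Tdeg: "card (M\<inverse> `` {t}) = 1 \<and> card ((E - M)\<inverse> `` {t}) = 1" if t: "t \<in> T" for t
  proof -
    have c: "card (E\<inverse> `` {t}) = 2" using FD(9)[OF t] by simp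
    then have "t \<in> ?R" using posR[of t] by simp
    then show ?thesis using inM[of t] TL[OF t] diff(2)[of t] c by (simp add: \<delta>_def)
  qed
  have deg: "card (M `` {v}) = card (M\<inverse> `` {v}) \<and> card (M `` {v}) \<le> 1 \<and>
      card ((E - M) `` {v}) = card ((E - M)\<inverse> `` {v}) \<and> card ((E - M) `` {v}) \<le> 1"
    if v: "i < card v" "card v < j" for v
  proof (cases "v \<in> ?L")
    case True
    have io: "card (E `` {v}) = card (E\<inverse> `` {v})" and le2: "card (E `` {v}) \<le> 2"
      using FD(10,11)[OF v] by auto
    have R: "v \<in> ?R" using True posL[of v] posR[of v] io by simp
    have "card (E `` {v}) - card (M `` {v}) \<le> 1"
    proof (cases "card (E `` {v}) = 2")
      case True
      then show ?thesis using \<delta>2[OF True] outM[OF \<open>v \<in> ?L\<close>] by simp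
    qed (use le2 in simp)
    then show ?thesis using outM[OF True] inM[OF R] io unfolding diff by auto
  next
    case False
    then have "E `` {v} = {}" by auto
    moreover have "v \<notin> ?R" using False posL[of v] posR[of v] FD(10)[OF v] by simp
    then have "E\<inverse> `` {v} = {}" by auto
    ultimately have "M `` {v} = {}" "M\<inverse> `` {v} = {}" "(E - M) `` {v} = {}" "(E - M)\<inverse> `` {v} = {}"
      using ME by auto
    then show ?thesis by simp
  qed
  have link: "linkage i j S T N"
    if N: "N \<subseteq> E" and NS: "\<And>s. s \<in> S \<Longrightarrow> card (N `` {s}) = 1" and NT: "\<And>t. t \<in> T \<Longrightarrow> card (N\<inverse> `` {t}) = 1"
      and Nd: "\<And>v. i < card v \<Longrightarrow> card v < j \<Longrightarrow> card (N `` {v}) = card (N\<inverse> `` {v}) \<and> card (N `` {v}) \<le> 1" for N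
    unfolding linkage_def layered_flow_def
  proof (intro conjI allI impI ballI)
    show "finite N" using N finE finite_subset by blast
    fix x y assume "(x, y) \<in> N"
    then have e: "(x, y) \<in> E" using N by blast
    show "x \<subseteq> y" "card y = Suc (card x)" "i \<le> card x" "card y \<le> j" "\<exists>s\<in>S. s \<subseteq> x" "\<exists>t\<in>T. y \<subseteq> t"
      by (rule FD(2-7)[OF e])+
  next
    fix v :: "'a set" assume v: "i < card v" "card v < j"
    show "card (N `` {v}) = card (N\<inverse> `` {v})" "card (N `` {v}) \<le> 2" "card (N `` {v}) \<le> 1"
      using Nd[OF v] by auto
  qed (use NS NT in auto)
  show thesis
  proof (rule that[OF ME])
    show "linkage i j S T M" by (rule link[OF ME]) (use Sdeg Tdeg deg in blast)+
    show "linkage i j S T (E - M)" by (rule link[OF Diff_subset]) (use Sdeg Tdeg deg in blast)+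
  qed
qed

lemma linkage_trajectories:
  assumes M: "linkage i j S T M" and S: "uniform i S" and T: "uniform j T" and ij: "i < j"
  obtains v :: "'a set \<Rightarrow> nat \<Rightarrow> 'a set" where
    "\<And>s. v s 0 = s"
    "\<And>s n. s \<in> S \<Longrightarrow> n < j - i \<Longrightarrow> (v s n, v s (Suc n)) \<in> M"
    "\<And>s n. s \<in> S \<Longrightarrow> n \<le> j - i \<Longrightarrow> card (v s n) = i + n"
    "\<And>s. s \<in> S \<Longrightarrow> v s (j - i) \<in> T"
    "\<And>s s' n. s \<in> S \<Longrightarrow> s' \<in> S \<Longrightarrow> n \<le> j - i \<Longrightarrow> v s n = v s' n \<Longrightarrow> s = s'"
proof -
  have F: "layered_flow i j S T (\<lambda>_. 1) (\<lambda>_. 1) M" using M by (simp add: linkage_def)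
  note FD = layered_flowD[OF F] and FE = layered_flow_ends[OF F S T]
  define nxt where "nxt = (\<lambda>x. the_elem (M `` {x}))"
  define v where "v = (\<lambda>s n. (nxt ^^ n) s)"
  have nxt: "(x, nxt x) \<in> M" if x: "card (M `` {x}) = 1" for x
  proof -
    obtain y where "M `` {x} = {y}" using x by (auto simp: card_1_singleton_iff)
    then show ?thesis by (auto simp: nxt_def)
  qed
  have out1: "card (v s n) = i + n \<and> card (M `` {v s n}) = 1" if "s \<in> S" "n < j - i" for s n
    using that(2)
  proof (induction n)
    case 0
    then show ?case using FD(8)[OF that(1)] uniformD(3)[OF S that(1)] by (simp add: v_def)
  next
    case (Suc n)
    then have "(v s n, v s (Suc n)) \<in> M" and c: "card (v s n) = i + n" using nxt[of "v s n"] by (auto simp: v_def)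
    then have e: "(v s n, v s (Suc n)) \<in> M" by simp
    have c': "card (v s (Suc n)) = i + Suc n" using FD(3)[OF e] c by simp
    have b: "i < card (v s (Suc n))" "card (v s (Suc n)) < j" using c' Suc.prems by auto
    have "card (M\<inverse> `` {v s (Suc n)}) \<noteq> 0" using e FD(1) by (auto simp: finite_Image)
    then have "card (M `` {v s (Suc n)}) \<noteq> 0" using FD(10)[OF b] by simp
    moreover have "card (M `` {v s (Suc n)}) \<le> 1" using M b by (simp add: linkage_def)
    ultimately show ?case using c' by simp
  qed
  have edge: "(v s n, v s (Suc n)) \<in> M" if "s \<in> S" "n < j - i" for s n
    using nxt[of "v s n"] out1[OF that] by (simp add: v_def)
  have cardv: "card (v s n) = i + n" if "s \<in> S" "n \<le> j - i" for s n
  proof (cases n)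
    case 0
    then show ?thesis using uniformD(3)[OF S that(1)] by (simp add: v_def)
  next
    case (Suc m)
    then show ?thesis using FD(3)[OF edge[of s m]] out1[of s m] that by simp
  qed
  have inT: "v s (j - i) \<in> T" if s: "s \<in> S" for s
  proof -
    have "(v s (j - i - 1), v s (j - i)) \<in> M" using edge[OF s, of "j - i - 1"] ij by (simp add: Suc_diff_Suc)
    then show ?thesis using FE(2) cardv[OF s, of "j - i"] ij by simp
  qed
  have inj: "s = s'" if s: "s \<in> S" "s' \<in> S" and "n \<le> j - i" "v s n = v s' n" for s s' n
    using that(3,4)
  proof (induction n)
    case 0
    then show ?case by (simp add: v_def)
  next
    case (Suc n)
    let ?y = "v s (Suc n)"
    have e: "(v s n, ?y) \<in> M" "(v s' n, ?y) \<in> M" using edge[of s n] edge[of s' n] s Suc.prems by auto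
    have "card (M\<inverse> `` {?y}) \<le> 1"
    proof (cases "Suc n = j - i")
      case True
      then show ?thesis using inT[OF s(1)] FD(9)[of ?y] by simp
    next
      case False
      then have b: "i < card ?y" "card ?y < j" using cardv[OF s(1), of "Suc n"] Suc.prems by auto
      then have "card (M `` {?y}) \<le> 1" using M by (simp add: linkage_def)
      then show ?thesis using FD(10)[OF b] by simp
    qed
    moreover have "finite (M\<inverse> `` {?y})" using FD(1) by (simp add: finite_Image)
    ultimately have "v s n = v s' n" using e by (metis ImageI One_nat_def card_le_Suc0_iff_eq converse_iff singletonI)
    then show ?case using Suc by simp
  qed
  show thesis by (rule that[of v]) (use edge cardv inT inj in \<open>auto simp: v_def\<close>)
qed

section \<open>Back to the hypercube\<close>

definition ones :: "nat \<Rightarrow> vertex \<Rightarrow> nat set" where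
  "ones d x = {k \<in> {1..d}. x k = 1}"

definition ind :: "nat \<Rightarrow> nat set \<Rightarrow> vertex" where
  "ind d A = (\<lambda>k\<in>{1..d}. if k \<in> A then 1 else 0)"

lemma ind_in_cube: "ind d A \<in> cube d"
  by (auto simp: ind_def cube_def)

lemma ones_ind: "A \<subseteq> {1..d} \<Longrightarrow> ones d (ind d A) = A"
  by (auto simp: ones_def ind_def)

lemma ind_ones:
  assumes "x \<in> cube d"
  shows "ind d (ones d x) = x"
proof
  fix k
  have "x k \<in> {0, 1}" if "k \<in> {1..d}" using PiE_mem[OF assms[unfolded cube_def] that] .
  moreover have "x k = undefined" if "k \<notin> {1..d}" using PiE_arb[OF assms[unfolded cube_def] that] .
  ultimately show "ind d (ones d x) k = x k" by (auto simp: ind_def ones_def)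
qed

lemma inj_ind: "inj_on (ind d) (Pow {1..d})"
  by (rule inj_on_inverseI[where g = "ones d"]) (simp add: ones_ind)

lemma inj_ones: "inj_on (ones d) (cube d)"
  by (rule inj_on_inverseI[where g = "ind d"]) (simp add: ind_ones)

lemma card_ones:
  assumes "x \<in> layer d i"
  shows "card (ones d x) = i"
proof -
  have x: "x \<in> cube d" "(\<Sum>k = 1..d. x k) = i" using assms by (auto simp: layer_def)
  have "x k \<le> 1" if "k \<in> {1..d}" for k using PiE_mem[OF x(1)[unfolded cube_def] that] by auto
  then have "card {k \<in> {1..d}. x k = 1} = (\<Sum>k = 1..d. x k)" by (intro sum_01_card) auto
  then show ?thesis using x(2) by (simp add: ones_def)
qed

lemma ones_mono:
  assumes "cube_le d x y" "y \<in> cube d"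
  shows "ones d x \<subseteq> ones d y"
proof
  fix k assume k: "k \<in> ones d x"
  then have "k \<in> {1..d}" "x k = 1" by (auto simp: ones_def)
  then have "y k \<in> {0, 1}" "1 \<le> y k"
    using assms(1) PiE_mem[OF assms(2)[unfolded cube_def], of k] unfolding cube_le_def by metis+
  then show "k \<in> ones d y" using k by (auto simp: ones_def)
qed

lemma hypercube_arc:
  assumes "A \<subseteq> B" "B \<subseteq> {1..d}" "card B = Suc (card A)"
  shows "(ind d A, ind d B) \<in> parcs (hypercube d)"
proof -
  have fin: "finite B" using assms(2) finite_subset by blast
  have "{k \<in> {1..d}. ind d A k \<noteq> ind d B k} = B - A" using assms by (auto simp: ind_def)
  moreover have "card (B - A) = 1" using assms fin by (simp add: card_Diff_subset finite_subset)
  moreover have "{k \<in> {1..d}. ind d A k = 1} = A" "{k \<in> {1..d}. ind d B k = 1} = B"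
    using ones_ind[of A d] ones_ind[of B d] assms by (auto simp: ones_def)
  ultimately show ?thesis using assms(3) by (simp add: hypercube_def ind_in_cube)
qed

lemma set_vwalk_arcs_upt:
  "set (vwalk_arcs (map g [0..<Suc n])) = {(g m, g (Suc m)) |m. m < n}"
proof (induction n)
  case (Suc n)
  have "set (vwalk_arcs (map g [0..<Suc (Suc n)])) = set (vwalk_arcs (map g [0..<Suc n] @ [g (Suc n)]))" by simp
  also have "\<dots> = insert (last (map g [0..<Suc n]), g (Suc n)) (set (vwalk_arcs (map g [0..<Suc n])))"
    by (rule set_vwalk_arcs_snoc) simp
  also have "last (map g [0..<Suc n]) = g n" by simp
  finally show ?case unfolding Suc.IH by (auto simp: less_Suc_eq)
qed simp

lemma vwalk_arcs_fst_in_set: "(a, b) \<in> set (vwalk_arcs p) \<Longrightarrow> a \<in> set p"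
  by (induction p rule: vwalk_arcs.induct) auto

lemma vertex_disjoint_imp_edge_disjoint: "vertex_disjoint p q \<Longrightarrow> edge_disjoint p q"
  unfolding vertex_disjoint_def edge_disjoint_def using vwalk_arcs_fst_in_set by fastforce

lemma linkage_path_collection:
  assumes M: "linkage i j (ones d ` S) (ones d ` T) M" and ij: "i < j"
    and S: "S \<subseteq> layer d i" and T: "T \<subseteq> layer d j" and ST: "card S = card T"
  obtains P where "disjoint_path_collection d S T P"
    "\<And>p. p \<in> P \<Longrightarrow> set (vwalk_arcs p) \<subseteq> map_prod (ind d) (ind d) ` M"
proof -
  have SC: "S \<subseteq> cube d" and TC: "T \<subseteq> cube d" using S T by (auto simp: layer_def)
  have "finite (cube d)" unfolding cube_def by (intro finite_PiE) auto
  then have finS: "finite S" and finT: "finite T" using SC TC finite_subset by auto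
  have sub: "ones d x \<subseteq> {1..d}" for x by (auto simp: ones_def)
  then have fino: "finite (ones d x)" for x using finite_subset by blast
  have US: "uniform i (ones d ` S)" and UT: "uniform j (ones d ` T)"
    using finS finT fino card_ones S T by (auto simp: uniform_def)
  have F: "layered_flow i j (ones d ` S) (ones d ` T) (\<lambda>_. 1) (\<lambda>_. 1) M" using M by (simp add: linkage_def)
  note FD = layered_flowD[OF F]
  obtain v where v0: "\<And>s. v s 0 = s"
    and edge: "\<And>s n. s \<in> ones d ` S \<Longrightarrow> n < j - i \<Longrightarrow> (v s n, v s (Suc n)) \<in> M"
    and cardv: "\<And>s n. s \<in> ones d ` S \<Longrightarrow> n \<le> j - i \<Longrightarrow> card (v s n) = i + n"
    and inT: "\<And>s. s \<in> ones d ` S \<Longrightarrow> v s (j - i) \<in> ones d ` T"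
    and injv: "\<And>s s' n. s \<in> ones d ` S \<Longrightarrow> s' \<in> ones d ` S \<Longrightarrow> n \<le> j - i \<Longrightarrow> v s n = v s' n \<Longrightarrow> s = s'"
    using linkage_trajectories[OF M US UT ij] by blast
  have Msub: "x \<subseteq> {1..d} \<and> y \<subseteq> {1..d}" if "(x, y) \<in> M" for x y
    using FD(2,7)[OF that] sub by blast
  have vsub: "v s n \<subseteq> {1..d}" if "s \<in> ones d ` S" "n \<le> j - i" for s n
  proof (cases "n = j - i")
    case True
    then show ?thesis using inT[OF that(1)] sub by auto
  next
    case False
    then show ?thesis using edge[OF that(1), of n] Msub that(2) by simp
  qed
  define path where "path = (\<lambda>x. map (\<lambda>n. ind d (v (ones d x) n)) [0..<Suc (j - i)])"
  have arcs: "set (vwalk_arcs (path x)) = {(ind d (v (ones d x) n), ind d (v (ones d x) (Suc n))) |n. n < j - i}" for x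
    unfolding path_def by (rule set_vwalk_arcs_upt)
  have set_path: "set (path x) = (\<lambda>n. ind d (v (ones d x) n)) ` {..j - i}" for x
    unfolding path_def by (simp only: set_map set_upt) (auto simp: less_Suc_eq_le atLeast0LessThan)
  have eq: "n = m \<and> x = y" if xy: "x \<in> S" "y \<in> S" and nm: "n \<le> j - i" "m \<le> j - i"
      and e: "ind d (v (ones d x) n) = ind d (v (ones d y) m)" for x y n m
  proof -
    have ox: "ones d x \<in> ones d ` S" "ones d y \<in> ones d ` S" using xy by auto
    have ve: "v (ones d x) n = v (ones d y) m"
      using inj_onD[OF inj_ind e] vsub ox nm by simp
    then have "n = m" using cardv ox nm by (metis add_left_cancel)
    moreover from this have "ones d x = ones d y" using injv[OF ox nm(1)] ve by simp
    then have "x = y" using inj_onD[OF inj_ones] xy SC by blast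
    ultimately show ?thesis by simp
  qed
  have disj: "vertex_disjoint (path x) (path y)" if "x \<in> S" "y \<in> S" "x \<noteq> y" for x y
    unfolding vertex_disjoint_def set_path using eq[OF that(1,2)] that(3) by fastforce
  have hd: "hd (path x) = x" if "x \<in> S" for x
  proof -
    have "hd (path x) = ind d (v (ones d x) 0)" unfolding path_def by (simp add: hd_map del: upt_Suc)
    then show ?thesis using v0 ind_ones SC that by auto
  qed
  have last: "last (path x) \<in> T" if x: "x \<in> S" for x
  proof -
    have "last (path x) = ind d (v (ones d x) (j - i))" unfolding path_def by simp
    moreover obtain t where "t \<in> T" "v (ones d x) (j - i) = ones d t" using inT[of "ones d x"] x by auto
    ultimately show ?thesis using ind_ones TC by auto
  qed
  have vp: "vpath (path x) (with_proj (hypercube d))" if x: "x \<in> S" for x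
  proof -
    have ox: "ones d x \<in> ones d ` S" using x by simp
    have "path x \<noteq> []" by (simp add: path_def)
    moreover have "set (path x) \<subseteq> cube d" unfolding set_path using ind_in_cube by auto
    moreover have "set (vwalk_arcs (path x)) \<subseteq> parcs (hypercube d)"
    proof
      fix a assume "a \<in> set (vwalk_arcs (path x))"
      then obtain n where n: "n < j - i" "a = (ind d (v (ones d x) n), ind d (v (ones d x) (Suc n)))"
        unfolding arcs by blast
      show "a \<in> parcs (hypercube d)"
        unfolding n(2) using edge[OF ox n(1)] FD(2,3) Msub by (intro hypercube_arc) auto
    qed
    moreover have "distinct (path x)"
      unfolding path_def by (simp only: distinct_map distinct_upt, intro conjI TrueI inj_onI)
        (use eq[OF x x] in \<open>auto simp: less_Suc_eq_le\<close>)
    ultimately show ?thesis unfolding vpath_def vwalk_def by (simp add: hypercube_def)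
  qed
  have injp: "inj_on path S" using hd by (rule inj_on_inverseI[where g = hd])
  show thesis
  proof (rule that[of "path ` S"])
    show "disjoint_path_collection d S T (path ` S)"
      unfolding disjoint_path_collection_def
    proof (intro conjI ballI)
      show "finite (path ` S)" using finS by simp
      show "card (path ` S) = card S" "card (path ` S) = card T" using card_image[OF injp] ST by auto
      show "pairwise vertex_disjoint (path ` S)" by (rule pairwiseI) (use disj in auto)
      fix p assume "p \<in> path ` S"
      then show "vpath p (with_proj (hypercube d))" "hd p \<in> S" "last p \<in> T" using vp hd last by auto
    qed
    show "set (vwalk_arcs p) \<subseteq> map_prod (ind d) (ind d) ` M" if "p \<in> path ` S" for p
    proof
      fix a assume a: "a \<in> set (vwalk_arcs p)"
      obtain x where x: "x \<in> S" "p = path x" using \<open>p \<in> path ` S\<close> by blast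
      obtain n where n: "n < j - i" "a = (ind d (v (ones d x) n), ind d (v (ones d x) (Suc n)))"
        using a unfolding x(2) arcs by blast
      have "(v (ones d x) n, v (ones d x) (Suc n)) \<in> M" using edge n(1) x(1) by simp
      then show "a \<in> map_prod (ind d) (ind d) ` M" unfolding n(2) by (metis imageI map_prod_simp)
    qed
  qed
qed

theorem theorem1p2:
  fixes d i j :: nat
    and S T :: "vertex set"
    and \<phi> :: "vertex \<Rightarrow> vertex"
  assumes "d \<ge> 2"
    and "i < j" and "j \<le> d" and "j - i \<ge> 2"
    and "matched_pair d S T \<phi>"
    and "S \<subseteq> layer d i" and "T \<subseteq> layer d j"
  shows "\<exists>P1 P2.
    disjoint_path_collection d S T P1 \<and>
    disjoint_path_collection d S T P2 \<and>
    jointly_edge_disjoint P1 P2"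
proof -
  note S = assms(6) and T = assms(7)
  have SC: "S \<subseteq> cube d" and TC: "T \<subseteq> cube d" using S T by (auto simp: layer_def)
  have bij: "bij_betw \<phi> S T" and less: "\<And>s. s \<in> S \<Longrightarrow> cube_le d s (\<phi> s)"
    using assms(5) by (auto simp: matched_pair_def cube_less_def)
  have \<phi>T: "\<phi> s \<in> T" if "s \<in> S" for s using bij_betwE[OF bij] that by blast
  have "finite (cube d)" unfolding cube_def by (intro finite_PiE) auto
  then have finS: "finite S" and finT: "finite T" using SC TC finite_subset by auto
  have sub: "ones d x \<subseteq> {1..d}" for x by (auto simp: ones_def)
  then have fino: "finite (ones d x)" for x using finite_subset by blast
  let ?S = "ones d ` S" and ?T = "ones d ` T"
  have US: "uniform i ?S" and UT: "uniform j ?T"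
    using finS finT fino card_ones S T by (auto simp: uniform_def)
  have injS: "inj_on (ones d) S" and injT: "inj_on (ones d) T"
    using inj_ones SC TC by (auto intro: inj_on_subset)
  define f :: "nat set \<Rightarrow> nat set \<Rightarrow> nat" where
    "f = (\<lambda>a b. if b = ones d (\<phi> (ind d a)) then 2 else 0)"
  have f: "f (ones d s) b = (if b = ones d (\<phi> s) then 2 else 0)" if "s \<in> S" for s b
    using ind_ones SC that by (auto simp: f_def)
  have row: "(\<Sum>b\<in>?T. f a b) = 2" if a: "a \<in> ?S" for a
  proof -
    obtain s where s: "s \<in> S" "a = ones d s" using a by blast
    then show ?thesis using f[OF s(1)] \<phi>T[OF s(1)] finT by simp
  qed
  have col: "(\<Sum>a\<in>?S. f a b) = 2" if b: "b \<in> ?T" for b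
  proof -
    obtain t where t: "t \<in> T" "b = ones d t" using b by blast
    obtain s0 where s0: "s0 \<in> S" "t = \<phi> s0" using bij t(1) by (auto simp: bij_betw_def)
    have "(\<Sum>a\<in>?S. f a b) = (\<Sum>s\<in>S. f (ones d s) b)" using sum.reindex[OF injS, of "\<lambda>a. f a b"] by simp
    also have "\<dots> = (\<Sum>s\<in>S. if s = s0 then 2 else 0)"
    proof (rule sum.cong[OF refl])
      fix s assume s: "s \<in> S"
      have "ones d t = ones d (\<phi> s) \<longleftrightarrow> t = \<phi> s" using inj_on_eq_iff[OF injT t(1) \<phi>T[OF s]] .
      also have "\<dots> \<longleftrightarrow> s = s0" using inj_on_eq_iff[OF bij_betw_imp_inj_on[OF bij] s0(1) s] s0(2) by auto
      finally show "f (ones d s) b = (if s = s0 then 2 else 0)" using f[OF s] t(2) by simp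
    qed
    also have "\<dots> = 2" using finS s0 by simp
    finally show ?thesis .
  qed
  have "\<exists>E. layered_flow i j ?S ?T (\<lambda>a. \<Sum>b\<in>?T. f a b) (\<lambda>b. \<Sum>a\<in>?S. f a b) E"
  proof (rule layered_flow_exists[OF _ US UT])
    show "Suc i < j" using assms(2,4) by linarith
    show "a \<subseteq> b" if ab: "a \<in> ?S" "b \<in> ?T" "0 < f a b" for a b
    proof -
      obtain s where s: "s \<in> S" "a = ones d s" using ab by blast
      then have "b = ones d (\<phi> s)" using f[OF s(1)] ab(3) by (auto split: if_splits)
      then show ?thesis using ones_mono[OF less[OF s(1)]] \<phi>T[OF s(1)] TC s(2) by auto
    qed
  qed (use row col in auto)
  then obtain E where "layered_flow i j ?S ?T (\<lambda>a. \<Sum>b\<in>?T. f a b) (\<lambda>b. \<Sum>a\<in>?S. f a b) E" by blast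
  then have E: "layered_flow i j ?S ?T (\<lambda>_. 2) (\<lambda>_. 2) E"
    using row col by (rule layered_flow_cong)
  obtain M where M: "M \<subseteq> E" "linkage i j ?S ?T M" "linkage i j ?S ?T (E - M)"
    using layered_flow_2_split[OF E US UT] by blast
  have ST: "card S = card T" using bij by (rule bij_betw_same_card)
  obtain P1 where P1: "disjoint_path_collection d S T P1"
    "\<And>p. p \<in> P1 \<Longrightarrow> set (vwalk_arcs p) \<subseteq> map_prod (ind d) (ind d) ` M"
    using linkage_path_collection[OF M(2) assms(2) S T ST] by blast
  obtain P2 where P2: "disjoint_path_collection d S T P2"
    "\<And>p. p \<in> P2 \<Longrightarrow> set (vwalk_arcs p) \<subseteq> map_prod (ind d) (ind d) ` (E - M)"
    using linkage_path_collection[OF M(3) assms(2) S T ST] by blast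
  have Esub: "E \<subseteq> Pow {1..d} \<times> Pow {1..d}"
  proof
    fix e assume "e \<in> E"
    then have e: "(fst e, snd e) \<in> E" by simp
    have "fst e \<subseteq> {1..d}" "snd e \<subseteq> {1..d}" using layered_flowD(2,7)[OF E e] sub by blast+
    then show "e \<in> Pow {1..d} \<times> Pow {1..d}" by (simp add: mem_Times_iff)
  qed
  have injE: "inj_on (map_prod (ind d) (ind d)) E"
    by (rule inj_on_subset[OF map_prod_inj_on[OF inj_ind inj_ind] Esub])
  have cross: "map_prod (ind d) (ind d) ` M \<inter> map_prod (ind d) (ind d) ` (E - M) = {}"
    using inj_on_image_Int[OF injE M(1) Diff_subset, of M] by simp
  have within: "pairwise edge_disjoint P" if "disjoint_path_collection d S T P" for P
    using that by (auto simp: disjoint_path_collection_def pairwise_def intro!: vertex_disjoint_imp_edge_disjoint)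
  have "jointly_edge_disjoint P1 P2"
    unfolding jointly_edge_disjoint_def
  proof (intro conjI ballI)
    fix p q assume "p \<in> P1" "q \<in> P2"
    then show "edge_disjoint p q" using P1(2) P2(2) cross unfolding edge_disjoint_def by fast
  qed (use within P1(1) P2(1) in auto)
  then show ?thesis using P1(1) P2(1) by blast
qed

end
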